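(* Let $\mathbb{M}=(M_j)_{j\in\mathbb{N}_0}$ be a sequence of positive real numbers with $M_0=1$ and let $\alpha>0$. 1. If $\alpha\le 1$, assume that $\overline{\mathbb{G}}^{1-\alpha}\mathbb{M}:=(j^{(1-\alpha)j}M_j)_{j\in\mathbb{N}_0}$ is equivalent to a log-convex sequence $\mathbb{L}$ with $L_0=1$. Then $\mathcal{T}_{\mathbb{L}}(\widetilde{E}_\alpha)$ is characteristic in the class $\mathcal{A}_{\{\mathbb{M}\}}(S_\alpha)$. 2. If $\alpha>1$, assume that there exists $\alpha'>\alpha$ such that $\overline{\mathbb{G}}^{1-\alpha'}\mathbb{M}:=(j^{(1-\alpha')j}M_j)_{j\in\mathbb{N}_0}$ is equivalent to a log-convex sequence $\mathbb{L}$ with $L_0=1$. Then $\mathcal{T}_{\mathbb{L}}(g_{\alpha,\alpha'})$ is characteristic in the class $\mathcal{A}_{\{\mathbb{M}\}}(S_\alpha)$.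
   Context: $\mathbb{N}_0=\{0,1,2,\dots\}$, $0^0:=1$. A positive sequence $\mathbb{L}=(L_j)_{j\in\mathbb{N}_0}$ is log-convex if $L_j^2\le L_{j-1}L_{j+1}$ for all $j\ge1$. Two positive sequences $\mathbb{M},\mathbb{L}$ are equivalent if there are $A,B>0$ with $M_j\le AB^jL_j$ and $L_j\le AB^jM_j$ for all $j\in\mathbb{N}_0$. $\mathcal{R}$ is the Riemann surface of the logarithm and $S_\alpha:=\{z\in\mathcal{R}:|\arg z|<\alpha\pi/2\}$; derivatives are with respect to the coordinate $z$. For a positive sequence $\mathbb{M}$ and a sector $S$, $\mathcal{A}_{\{\mathbb{M}\}}(S)$ is the set of holomorphic $f$ on $S$ for which there is $h>0$ with $\sup_{z\in S,j\in\mathbb{N}_0}\frac{|f^{(j)}(z)|}{h^jM_j}<\infty$. A function $f\in\mathcal{A}_{\{\mathbb{M}\}}(S)$ is characteristic in the class $\mathcal{A}_{\{\mathbb{M}\}}(S)$ if, whenever $f\in\mathcal{A}_{\{\mathbb{N}\}}(S)\subseteq\mathcal{A}_{\{\mathbb{M}\}}(S)$ for some positive sequence $\mathbb{N}=(N_j)_j$, one has $\mathcal{A}_{\{\mathbb{N}\}}(S)=\mathcal{A}_{\{\mathbb{M}\}}(S)$. For a log-convex sequence $\mathbb{L}$ with quotients $\ell_j:=L_{j+1}/L_j$ and $f$ in some class $\mathcal{A}_{\{\mathbb{K}\}}(S)$ ($\mathbb{K}$ a positive sequence), the transform is $\mathcal{T}_{\mathbb{L}}(f)(z):=\sum_{j=0}^\infty\frac{1}{2^j}\frac{L_j}{\ell_j^j}f(\ell_jz)$,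 $z\in S$. For $\alpha\in(0,1]$, $\widetilde{E}_\alpha(z):=\sum_{j=0}^\infty\frac{(-1)^jz^j}{\Gamma((2-\alpha)(j+1)+2)}$, $z\in\mathbb{C}$ (restricted to $S_\alpha$). For $\alpha>1$ and $\alpha'>\alpha$, $g_{\alpha,\alpha'}(z):=\int_0^{\infty(-\phi)}e^{-zv^{\alpha'-1}}e^{-v}\,dv$ for $z\in S_\alpha$, the integral being along the ray $\arg v=-\phi$, where $\phi\in\left(-\frac{\alpha-1}{\alpha'-1}\frac{\pi}{2},\frac{\alpha-1}{\alpha'-1}\frac{\pi}{2}\right)$ is chosen with $|\arg(z)-(\alpha'-1)\phi|<\pi/2$ (the value does not depend on the choice of such $\phi$). *)

theory Defs
  imports "HOL-Complex_Analysis.Complex_Analysis"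
begin

section \<open>The Riemann surface of the logarithm\<close>

text \<open>A point \<open>z\<close> of the Riemann surface of the logarithm is given by its logarithm, an arbitrary
  complex number \<open>ln \<bar>z\<bar> + \<i> arg z\<close>; this is a global (biholomorphic) chart.  The coordinate
  \<open>z\<close> itself is only a local chart: it is the covering map \<open>exp \<circ> rlog\<close>.\<close>

datatype logsurf = LogPt (rlog: complex)

definition coord :: "logsurf \<Rightarrow> complex" where
  "coord z = exp (rlog z)"

definition rarg :: "logsurf \<Rightarrow> real" where
  "rarg z = Im (rlog z)"

text \<open>Multiplication of a point by a positive real \<open>c\<close> (modulus scaled, argument unchanged).\<close>

definition rscale :: "real \<Rightarrow> logsurf \<Rightarrow> logsurf" where
  "rscale c z = LogPt (of_real (ln c) + rlog z)"

definition sector :: "real \<Rightarrow> logsurf set" where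
  "sector \<alpha> = {z. \<bar>rarg z\<bar> < \<alpha> * pi / 2}"

definition rholomorphic_on :: "(logsurf \<Rightarrow> complex) \<Rightarrow> logsurf set \<Rightarrow> bool" where
  "rholomorphic_on f S \<longleftrightarrow> (\<lambda>w. f (LogPt w)) holomorphic_on (rlog ` S)"

text \<open>\<open>rlift z\<close> is the branch of the inverse of \<open>coord\<close> defined near \<open>coord z\<close> that sends
  \<open>coord z\<close> to \<open>z\<close>; hence \<open>rderiv f\<close> is the derivative of \<open>f\<close> with respect to the coordinate \<open>z\<close>.\<close>

definition rlift :: "logsurf \<Rightarrow> complex \<Rightarrow> logsurf" where
  "rlift z \<zeta> = LogPt (rlog z + Ln (\<zeta> / coord z))"

definition rderiv :: "(logsurf \<Rightarrow> complex) \<Rightarrow> logsurf \<Rightarrow> complex" where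
  "rderiv f z = deriv (\<lambda>\<zeta>. f (rlift z \<zeta>)) (coord z)"

lemma coord_rlift: "\<zeta> \<noteq> 0 \<Longrightarrow> coord (rlift z \<zeta>) = \<zeta>"
  by (simp add: coord_def rlift_def exp_add)

lemma rlift_coord: "rlift z (coord z) = z"
  by (simp add: coord_def rlift_def)

lemma rderiv_eq:
  assumes "(\<lambda>w. f (LogPt w)) field_differentiable at (rlog z)"
  shows "rderiv f z = deriv (\<lambda>w. f (LogPt w)) (rlog z) / coord z"
proof -
  let ?F = "\<lambda>w. f (LogPt w)" and ?h = "\<lambda>\<zeta>. rlog z + Ln (\<zeta> / coord z)"
  have nz: "coord z \<noteq> 0"
    by (simp add: coord_def)
  have h: "(?h has_field_derivative 1 / coord z) (at (coord z))"
    using nz by (auto intro!: derivative_eq_intros simp: complex_nonpos_Reals_iff)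
  have "(?F has_field_derivative deriv ?F (rlog z)) (at (?h (coord z)))"
    using assms nz by (simp add: field_differentiable_derivI)
  from DERIV_chain2[OF this h] show ?thesis
    unfolding rderiv_def rlift_def by (simp add: DERIV_imp_deriv)
qed

section \<open>Weight sequences and ultraholomorphic classes\<close>

definition pos_seq :: "(nat \<Rightarrow> real) \<Rightarrow> bool" where
  "pos_seq M \<longleftrightarrow> (\<forall>j. M j > 0)"

definition log_convex :: "(nat \<Rightarrow> real) \<Rightarrow> bool" where
  "log_convex L \<longleftrightarrow> pos_seq L \<and> (\<forall>j\<ge>1. (L j)\<^sup>2 \<le> L (j - 1) * L (j + 1))"

definition seq_equiv :: "(nat \<Rightarrow> real) \<Rightarrow> (nat \<Rightarrow> real) \<Rightarrow> bool" where
  "seq_equiv M L \<longleftrightarrow>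
     (\<exists>A>0. \<exists>B>0. \<forall>j. M j \<le> A * B ^ j * L j \<and> L j \<le> A * B ^ j * M j)"

text \<open>The sequence \<open>j\<^bsup>\<beta>j\<^esup> M\<^sub>j\<close>.  The case distinction implements \<open>0\<^sup>0 = 1\<close>, since \<open>0 powr 0 = 0\<close>.\<close>

definition Gbar :: "real \<Rightarrow> (nat \<Rightarrow> real) \<Rightarrow> nat \<Rightarrow> real" where
  "Gbar \<beta> M j = (if j = 0 then 1 else real j powr (\<beta> * real j)) * M j"

text \<open>For open \<open>S\<close>, membership depends only on the values of \<open>f\<close> on \<open>S\<close>.\<close>

definition ultra_class :: "(nat \<Rightarrow> real) \<Rightarrow> logsurf set \<Rightarrow> (logsurf \<Rightarrow> complex) set" where
  "ultra_class M S = {f. rholomorphic_on f S \<and>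
     (\<exists>h>0. bdd_above {norm ((rderiv ^^ j) f z) / (h ^ j * M j) | z j. z \<in> S})}"

definition characteristic ::
    "(logsurf \<Rightarrow> complex) \<Rightarrow> (nat \<Rightarrow> real) \<Rightarrow> logsurf set \<Rightarrow> bool" where
  "characteristic f M S \<longleftrightarrow> f \<in> ultra_class M S \<and>
     (\<forall>N. pos_seq N \<and> f \<in> ultra_class N S \<and> ultra_class N S \<subseteq> ultra_class M S
        \<longrightarrow> ultra_class N S = ultra_class M S)"

definition quot :: "(nat \<Rightarrow> real) \<Rightarrow> nat \<Rightarrow> real" where
  "quot L j = L (j + 1) / L j"

definition transform :: "(nat \<Rightarrow> real) \<Rightarrow> (logsurf \<Rightarrow> complex) \<Rightarrow> logsurf \<Rightarrow> complex" where
  "transform L f z =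
     (\<Sum>j. of_real (1 / 2 ^ j * (L j / quot L j ^ j)) * f (rscale (quot L j) z))"

section \<open>The basic functions\<close>

definition Etilde :: "real \<Rightarrow> complex \<Rightarrow> complex" where
  "Etilde \<alpha> z =
     (\<Sum>j. (-1) ^ j * z ^ j / of_real (Gamma ((2 - \<alpha>) * (real j + 1) + 2)))"

definition ray_integral :: "real \<Rightarrow> (complex \<Rightarrow> complex) \<Rightarrow> complex" where
  "ray_integral \<theta> F = (LBINT t:{0<..}. F (of_real t * cis \<theta>) * cis \<theta>)"

definition admissible_angle :: "real \<Rightarrow> real \<Rightarrow> logsurf \<Rightarrow> real \<Rightarrow> bool" where
  "admissible_angle \<alpha> \<alpha>' z \<phi> \<longleftrightarrow>
     - ((\<alpha> - 1) / (\<alpha>' - 1) * (pi / 2)) < \<phi> \<and> \<phi> < (\<alpha> - 1) / (\<alpha>' - 1) * (pi / 2) \<and>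
     \<bar>rarg z - (\<alpha>' - 1) * \<phi>\<bar> < pi / 2"

text \<open>For \<open>1 < \<alpha> < \<alpha>'\<close> an admissible \<open>\<phi>\<close> has \<open>\<bar>\<phi>\<bar> < \<pi>/2\<close>, so on the ray \<open>arg v = -\<phi>\<close> the
  principal power \<open>powr\<close> is the intended one.  The integral is independent of the choice of \<open>\<phi>\<close>.\<close>

definition g_fun :: "real \<Rightarrow> real \<Rightarrow> logsurf \<Rightarrow> complex" where
  "g_fun \<alpha> \<alpha>' z =
     ray_integral (- (SOME \<phi>. admissible_angle \<alpha> \<alpha>' z \<phi>))
       (\<lambda>v. exp (- (coord z * v powr of_real (\<alpha>' - 1))) * exp (- v))"

end

theory Submission
  imports Defs "HOL-Probability.Sinc_Integral"
begin

text \<open>Log-convexity gives \<open>L\<^sub>j \<ell>\<^sub>j\<^bsup>n-j\<^esup> \<le> L\<^sub>n\<close> with equality for \<open>j = n\<close>, so the transform multiplies the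
  size of the \<open>n\<close>-th derivative of the basic function by at most \<open>2 L\<^sub>n\<close>, and multiplies its
  boundary value at the vertex of the sector by at least \<open>L\<^sub>n / 2\<^sup>n\<close>.  Hence it suffices that on
  the sector the derivatives of the basic function are bounded by \<open>A H\<^sup>n G\<^sub>n\<close>, with limits at the
  vertex at least \<open>a h\<^sup>n G\<^sub>n\<close>, where \<open>G\<^sub>n = n\<^bsup>(\<alpha>-1)n\<^esup>\<close> or \<open>G\<^sub>n = n\<^bsup>(\<alpha>'-1)n\<^esup>\<close>.  For \<open>g\<close> this is the Gamma
  integral, once the integral is known not to depend on the ray.  For the Mittag-Leffler type function
  with \<open>a = 2 - \<alpha>\<close>, inverting the Laplace transform along \<open>Re u = r\<close> gives
  \<open>1/(2 \<pi>) \<integral> exp u u\<^sup>-\<^sup>2 / (u\<^sup>a + z)\<close>.  The denominator stays away from zero for \<open>z\<close> in a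
  \<open>\<rho>\<close>-neighbourhood of the sector when \<open>r\<^sup>a\<close> is comparable to \<open>\<rho>\<close>, and Cauchy's inequality with
  \<open>\<rho> = (n+1)\<^sup>a\<close> gives the bound.  Contour shifts are replaced by the remark that the integral is
  holomorphic in the complexified contour parameter and invariant in one real direction, hence
  constant.\<close>

section \<open>Characteristic transforms\<close>

definition logstrip :: "real \<Rightarrow> complex set" where
  "logstrip \<alpha> = {w. \<bar>Im w\<bar> < \<alpha> * pi / 2}"

lemma open_logstrip: "open (logstrip \<alpha>)"
  unfolding logstrip_def by (intro open_Collect_less continuous_intros)

lemma rlog_image_sector: "rlog ` sector \<alpha> = logstrip \<alpha>"
proof -
  have "w \<in> rlog ` sector \<alpha>" if "w \<in> logstrip \<alpha>" for w
    using that by (intro image_eqI[of _ _ "LogPt w"]) (auto simp: logstrip_def sector_def rarg_def)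
  then show ?thesis by (auto simp: logstrip_def sector_def rarg_def)
qed

lemma rlog_in_logstrip: "z \<in> sector \<alpha> \<longleftrightarrow> rlog z \<in> logstrip \<alpha>"
  by (simp add: logstrip_def sector_def rarg_def)

text \<open>In the logarithmic chart \<open>w = log z\<close> the coordinate derivative is \<open>exp (-w) d/dw\<close>; a tower
  lists the successive coordinate derivatives of \<open>F 0\<close>.\<close>

definition deriv_tower :: "complex set \<Rightarrow> (nat \<Rightarrow> complex \<Rightarrow> complex) \<Rightarrow> bool" where
  "deriv_tower U F \<longleftrightarrow>
     (\<forall>n. \<forall>w\<in>U. (F n has_field_derivative exp w * F (Suc n) w) (at w))"

text \<open>Induction on \<open>n\<close>: since \<open>U\<close> is open, the \<open>n\<close>-th
  iterate coincides with \<open>F n\<close> near \<open>w\<close>, so both have the same derivative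
  in the chart, and \<open>rderiv_eq\<close> divides it by \<open>exp w\<close>.\<close>

lemma rderiv_funpow_tower:
  assumes U: "open U" and F: "deriv_tower U F" and f: "\<And>w. w \<in> U \<Longrightarrow> f (LogPt w) = F 0 w"
    and w: "w \<in> U"
  shows "(rderiv ^^ n) f (LogPt w) = F n w"
  using w
proof (induction n arbitrary: w)
  case 0
  then show ?case by (simp add: f)
next
  case (Suc n)
  have "((\<lambda>w. (rderiv ^^ n) f (LogPt w)) has_field_derivative exp w * F (Suc n) w) (at w)"
    by (rule has_field_derivative_transform_within_open[of "F n" _ _ U])
      (use Suc F U in \<open>auto simp: deriv_tower_def\<close>)
  then show ?case
    using rderiv_eq[of "(rderiv ^^ n) f" "LogPt w"]
    by (auto simp: field_differentiable_def coord_def DERIV_imp_deriv)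
qed

section \<open>Log-convex sequences and their quotients\<close>

lemma log_convex_pos: "log_convex L \<Longrightarrow> L n > 0"
  by (simp add: log_convex_def pos_seq_def)

lemma quot_pos: "log_convex L \<Longrightarrow> quot L n > 0"
  by (simp add: quot_def log_convex_pos)

lemma quot_mono:
  assumes "log_convex L" "m \<le> n"
  shows "quot L m \<le> quot L n"
proof (rule lift_Suc_mono_le[OF _ assms(2)])
  fix n
  have "(L (Suc n))\<^sup>2 \<le> L (Suc n - 1) * L (Suc n + 1)"
    using assms(1) unfolding log_convex_def by auto
  then show "quot L n \<le> quot L (Suc n)"
    using log_convex_pos[OF assms(1)] by (simp add: quot_def field_simps power2_eq_square)
qed

text \<open>A convex sequence lies above each of its tangents, here for log \<open>L\<close> and the
  line through its points at \<open>j\<close> and \<open>j + 1\<close>. The quotients increase, so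
  the factors leading from \<open>L j\<close> up to \<open>L n\<close> are at least
  \<open>quot L j\<close>, while those leading from \<open>L n\<close> up to \<open>L j\<close> are
  at most \<open>quot L j\<close>.\<close>

lemma log_convex_tangent:
  assumes L: "log_convex L"
  shows "L j / quot L j ^ j * quot L j ^ n \<le> L n"
proof -
  note pos = log_convex_pos[OF L] quot_pos[OF L, of j]
  have step: "L (Suc k) = L k * quot L k" for k
    using pos(1)[of k] by (simp add: quot_def)
  have up: "L j * quot L j ^ k \<le> L (j + k)" for k
  proof (induction k)
    case (Suc k)
    have "L j * quot L j ^ Suc k \<le> L (j + k) * quot L j"
      using Suc pos(2) by (simp add: mult.commute mult.left_commute)
    also have "\<dots> \<le> L (j + k) * quot L (j + k)"
      by (intro mult_left_mono quot_mono[OF L]) (simp_all add: pos(1) less_imp_le)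
    finally show ?case by (simp add: step)
  qed simp
  have down: "L (m + k) \<le> L m * quot L j ^ k" if "m + k \<le> j" for m k
    using that
  proof (induction k)
    case (Suc k)
    have "L (m + Suc k) \<le> L (m + k) * quot L j"
      using Suc.prems by (auto simp: step less_imp_le[OF pos(1)] intro!: mult_left_mono quot_mono[OF L])
    also have "\<dots> \<le> L m * quot L j ^ k * quot L j"
      using Suc pos(2) by (intro mult_right_mono) auto
    finally show ?case by (simp add: mult_ac)
  qed simp
  show ?thesis
  proof (cases "j \<le> n")
    case True
    then obtain k where k: "n = j + k" using le_Suc_ex by blast
    show ?thesis using up[of k] pos by (simp add: k power_add)
  next
    case False
    then obtain k where k: "j = n + k" using le_Suc_ex nat_le_linear by blast
    have "L j * quot L j ^ n \<le> L n * quot L j ^ k * quot L j ^ n"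
      using down[of n k] k pos by (intro mult_right_mono) auto
    also have "\<dots> = L n * quot L j ^ j"
      by (simp add: k power_add mult_ac)
    finally show ?thesis using pos(2) by (simp add: field_simps)
  qed
qed

section \<open>Series of towers and a criterion for characteristic functions\<close>

text \<open>The Weierstrass test at level \<open>n\<close> allows termwise differentiation. The
  differentiated series is \<open>exp w\<close> times the series at level \<open>n + 1\<close>,
  which converges by the majorant of that level.\<close>

lemma deriv_tower_suminf:
  fixes F :: "nat \<Rightarrow> nat \<Rightarrow> complex \<Rightarrow> complex" and m :: "nat \<Rightarrow> nat \<Rightarrow> real"
  assumes U: "open U" and tower: "\<And>j. deriv_tower U (F j)"
    and bound: "\<And>j n w. w \<in> U \<Longrightarrow> norm (F j n w) \<le> m n j" and summ: "\<And>n. summable (m n)"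
  shows "deriv_tower U (\<lambda>n w. \<Sum>j. F j n w)"
  unfolding deriv_tower_def
proof (intro allI ballI)
  fix n w assume w: "w \<in> U"
  have "\<And>j w. w \<in> U \<Longrightarrow> (F j n has_field_derivative exp w * F j (Suc n) w) (at w)"
    using tower by (simp add: deriv_tower_def)
  moreover have "\<forall>\<^sub>F j in sequentially. \<forall>w\<in>U. norm (F j n w) \<le> m n j"
    using bound by simp
  ultimately obtain g g' where g: "\<forall>x\<in>U. (\<lambda>j. F j n x) sums g x \<and>
      (\<lambda>j. exp x * F j (Suc n) x) sums g' x \<and> (g has_field_derivative g' x) (at x)"
    using series_and_derivative_comparison[OF U summ[of n],
        of "\<lambda>j. F j n" "\<lambda>j x. exp x * F j (Suc n) x"] by blast
  have s: "summable (\<lambda>j. F j (Suc n) w)"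
    by (rule summable_comparison_test[OF _ summ[of "Suc n"]]) (use bound[OF w] in auto)
  have "g' w = exp w * (\<Sum>j. F j (Suc n) w)"
    using g w suminf_mult[OF s, of "exp w"] by (metis sums_unique)
  moreover have "((\<lambda>w. \<Sum>j. F j n w) has_field_derivative g' w) (at w)"
    by (rule has_field_derivative_transform_within_open[of g _ _ U])
      (use g w U in \<open>auto simp: sums_iff\<close>)
  ultimately show "((\<lambda>w. \<Sum>j. F j n w) has_field_derivative exp w * (\<Sum>j. F j (Suc n) w)) (at w)"
    by simp
qed

text \<open>The geometric factor \<open>B ^ n\<close> is absorbed into the parameter
  \<open>h\<close> of the class, which becomes \<open>h * B\<close>.\<close>

lemma ultra_class_mono:
  assumes le: "\<And>n. M n \<le> C * B ^ n * N n" and "C > 0" "B > 0" "pos_seq M" "pos_seq N"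
  shows "ultra_class M S \<subseteq> ultra_class N S"
proof
  fix f assume "f \<in> ultra_class M S"
  then obtain h K where f: "rholomorphic_on f S" "h > 0"
      and K: "\<And>z j. z \<in> S \<Longrightarrow> norm ((rderiv ^^ j) f z) / (h ^ j * M j) \<le> K"
    by (auto simp: ultra_class_def bdd_above_def) blast
  have M: "M n > 0" and N: "N n > 0" for n using assms by (auto simp: pos_seq_def)
  have "norm ((rderiv ^^ j) f z) / ((h * B) ^ j * N j) \<le> C * K" if z: "z \<in> S" for z j
  proof -
    have "norm ((rderiv ^^ j) f z) \<le> K * (h ^ j * M j)"
      using K[OF z, of j] M[of j] f(2) by (simp add: pos_divide_le_eq)
    moreover have "K \<ge> 0"
      by (rule order_trans[OF _ K[OF z, of j]]) (use M[of j] f(2) in simp)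
    ultimately have "norm ((rderiv ^^ j) f z) \<le> K * (h ^ j * (C * B ^ j * N j))"
      using le[of j] f(2) by (smt (verit) mult_left_mono zero_le_power)
    then show ?thesis
      using N[of j] f(2) \<open>B > 0\<close> by (simp add: pos_divide_le_eq power_mult_distrib mult_ac)
  qed
  then have "bdd_above {norm ((rderiv ^^ j) f z) / ((h * B) ^ j * N j) | z j. z \<in> S}"
    by (auto simp: bdd_above_def)
  then show "f \<in> ultra_class N S"
    using f \<open>B > 0\<close> unfolding ultra_class_def by (auto intro!: exI[of _ "h * B"])
qed

lemma suminf_half_power: "summable (\<lambda>j. C * (1 / 2 ^ j :: real))" "(\<Sum>j. C * (1 / 2 ^ j :: real)) = 2 * C"
proof -
  have "(\<lambda>j. (1 / 2) ^ j :: real) sums (1 / (1 - 1 / 2))" by (rule geometric_sums) simp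
  then have "(\<lambda>j. C * (1 / 2 ^ j :: real)) sums (C * 2)"
    by (intro sums_mult) (simp add: power_divide)
  then show "summable (\<lambda>j. C * (1 / 2 ^ j :: real))" "(\<Sum>j. C * (1 / 2 ^ j :: real)) = 2 * C"
    by (auto simp: sums_iff mult.commute)
qed

text \<open>The upper bounds put the transform into the class of \<open>M\<close>. For the converse,
  its derivatives tend at the vertex to numbers of size at least \<open>G n * L n\<close> up to
  geometric factors. If the transform belongs to the class of \<open>N\<close>, these limits are
  also bounded by \<open>N\<close>, so \<open>M\<close> is dominated by \<open>N\<close> and the
  class of \<open>M\<close> lies in that of \<open>N\<close>.\<close>

lemma characteristic_transformI:
  fixes F :: "nat \<Rightarrow> complex \<Rightarrow> complex" and G L M :: "nat \<Rightarrow> real" and c :: "nat \<Rightarrow> complex"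
  assumes \<alpha>: "\<alpha> > 0" and tower: "deriv_tower (logstrip \<alpha>) F"
    and f: "\<And>w. w \<in> logstrip \<alpha> \<Longrightarrow> f (LogPt w) = F 0 w"
    and bound: "\<And>n w. w \<in> logstrip \<alpha> \<Longrightarrow> norm (F n w) \<le> A * H ^ n * G n" and H: "H > 0"
    and lim: "\<And>n. ((\<lambda>x::real. F n (of_real x)) \<longlongrightarrow> c n) at_bot"
    and lower: "\<And>n. a * h ^ n * G n \<le> norm (c n)" and ah: "a > 0" "h > 0"
    and pos: "pos_seq G" "pos_seq M" and L: "log_convex L"
    and equiv: "seq_equiv M (\<lambda>n. G n * L n)"
  shows "characteristic (transform L f) M (sector \<alpha>)"
proof -
  let ?U = "logstrip \<alpha>" and ?q = "quot L"
  \<comment> \<open>\<open>b j\<close> is the coefficient of the \<open>j\<close>-th summand and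
    \<open>Q j n\<close> the \<open>n\<close>-th coordinate derivative of that summand. Scaling the
    argument by \<open>quot L j\<close> is a translation in the logarithmic chart, and each
    derivative brings out one factor \<open>quot L j\<close>.\<close>
  define b where "b j = 1 / 2 ^ j * (L j / ?q j ^ j)" for j
  define Q where "Q j n w = of_real (b j * ?q j ^ n) * F n (of_real (ln (?q j)) + w)" for j n w
  define T where "T n w = (\<Sum>j. Q j n w)" for n w
  note Lpos = log_convex_pos[OF L] and qpos = quot_pos[OF L]
  have Gpos: "G n > 0" and Mpos: "M n > 0" for n using pos by (auto simp: pos_seq_def)
  have shift: "of_real t + w \<in> ?U" if "w \<in> ?U" for t w
    using that by (simp add: logstrip_def)
  have real_in: "of_real x \<in> ?U" for x :: real
    using \<alpha> by (simp add: logstrip_def)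
  have bpos: "b j > 0" for j using Lpos qpos by (simp add: b_def)
  have b_le: "b j * ?q j ^ n \<le> L n * (1 / 2 ^ j)" for j n
    using log_convex_tangent[OF L, of j n] by (simp add: b_def field_simps)
  \<comment> \<open>The tangent touches at \<open>j = n\<close>. This single summand provides the
    lower bound for \<open>s n\<close> below.\<close>
  have b_eq: "b n * ?q n ^ n = L n * (1 / 2 ^ n)" for n
    using qpos[of n] by (simp add: b_def)
  have Qbound: "norm (Q j n w) \<le> A * H ^ n * G n * L n * (1 / 2 ^ j)" if "w \<in> ?U" for j n w
  proof -
    have "norm (Q j n w) = b j * ?q j ^ n * norm (F n (of_real (ln (?q j)) + w))"
      using bpos[of j] qpos[of j] by (simp add: Q_def norm_mult norm_power)
    also have "\<dots> \<le> (L n * (1 / 2 ^ j)) * (A * H ^ n * G n)"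
      by (rule mult_mono[OF b_le bound[OF shift[OF that]]]) (use Lpos[of n] in auto)
    finally show ?thesis by (simp add: mult_ac)
  qed
  have Qtower: "deriv_tower ?U (Q j)" for j
    unfolding deriv_tower_def
  proof (intro allI ballI)
    fix n w assume w: "w \<in> ?U"
    let ?t = "of_real (ln (?q j)) + w :: complex"
    have "(F n has_field_derivative exp ?t * F (Suc n) ?t) (at ?t)"
      using tower shift[OF w] by (simp add: deriv_tower_def)
    then have "((\<lambda>w. F n (of_real (ln (?q j)) + w)) has_field_derivative exp ?t * F (Suc n) ?t) (at w)"
      using DERIV_shift[of "F n" _ w "of_real (ln (?q j))"] by (simp add: add.commute)
    then have "(Q j n has_field_derivative of_real (b j * ?q j ^ n) * (exp ?t * F (Suc n) ?t)) (at w)"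
      unfolding Q_def by (rule DERIV_cmult)
    moreover have "exp ?t = of_real (?q j) * exp w"
      using qpos[of j] by (simp add: exp_add exp_of_real)
    ultimately show "(Q j n has_field_derivative exp w * Q j (Suc n) w) (at w)"
      by (simp add: Q_def mult_ac)
  qed
  have Ttower: "deriv_tower ?U T"
    unfolding T_def
    by (rule deriv_tower_suminf[OF open_logstrip Qtower Qbound suminf_half_power(1)])
  have tf: "transform L f (LogPt w) = T 0 w" if "w \<in> ?U" for w
    unfolding transform_def T_def Q_def using f[OF shift[OF that]]
    by (simp add: rscale_def b_def)
  note derivs = rderiv_funpow_tower[of ?U T "transform L f", OF open_logstrip Ttower tf]
  have T_le: "norm (T n w) \<le> 2 * (A * H ^ n * G n * L n)" if "w \<in> ?U" for n w
  proof -
    have "norm (T n w) \<le> (\<Sum>j. A * H ^ n * G n * L n * (1 / 2 ^ j))"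
      unfolding T_def by (rule norm_suminf_le[OF Qbound[OF that] suminf_half_power(1)])
    then show ?thesis by (simp only: suminf_half_power(2))
  qed
  obtain A' B where AB: "A' > 0" "B > 0"
    "\<And>n. M n \<le> A' * B ^ n * (G n * L n)" "\<And>n. G n * L n \<le> A' * B ^ n * M n"
    using equiv by (auto simp: seq_equiv_def)
  have A: "A \<ge> 0"
    using order_trans[OF norm_ge_zero bound[OF real_in, of 0 0]] Gpos[of 0]
    by (simp add: zero_le_mult_iff)
  have holo: "rholomorphic_on (transform L f) (sector \<alpha>)"
    unfolding rholomorphic_on_def rlog_image_sector
  proof (rule holomorphic_transform[of "T 0"])
    show "T 0 holomorphic_on ?U"
      using Ttower by (auto simp: holomorphic_on_open[OF open_logstrip] deriv_tower_def)
  qed (simp add: tf)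
  have "norm ((rderiv ^^ j) (transform L f) z) / ((H * B) ^ j * M j) \<le> 2 * A * A'"
    if "z \<in> sector \<alpha>" for z j
  proof -
    from that have z: "rlog z \<in> ?U" by (simp add: rlog_in_logstrip)
    have "norm ((rderiv ^^ j) (transform L f) z) \<le> 2 * (A * H ^ j * (G j * L j))"
      using derivs[OF _ z, of j] T_le[OF z, of j] by (simp add: mult_ac)
    also have "\<dots> \<le> 2 * (A * H ^ j * (A' * B ^ j * M j))"
      using AB(4)[of j] A H by (intro mult_left_mono) auto
    finally show ?thesis
      using Mpos[of j] H AB(2) by (simp add: pos_divide_le_eq power_mult_distrib mult_ac)
  qed
  then have "bdd_above {norm ((rderiv ^^ j) (transform L f) z) / ((H * B) ^ j * M j) | z j. z \<in> sector \<alpha>}"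
    by (intro bdd_aboveI[where M = "2 * A * A'"]) auto
  then have mem: "transform L f \<in> ultra_class M (sector \<alpha>)"
    unfolding ultra_class_def using holo H AB(2) by (auto intro!: exI[of _ "H * B"])

  \<comment> \<open>The transform multiplies the vertex limit of the \<open>n\<close>-th derivative
    by \<open>s n\<close>. All its terms are positive, so it is at least its \<open>n\<close>-th
    term.\<close>
  define s where "s n = (\<Sum>j. b j * ?q j ^ n)" for n
  have s_summ: "summable (\<lambda>j. b j * ?q j ^ n)" for n
    by (rule summable_comparison_test[OF _ suminf_half_power(1)[of "L n"]])
      (use b_le bpos qpos in \<open>auto simp: less_imp_le\<close>)
  have s_ge: "L n / 2 ^ n \<le> s n" for n
  proof -
    have "(\<Sum>j\<in>{n}. b j * ?q j ^ n) \<le> s n"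
      unfolding s_def using s_summ bpos qpos by (intro sum_le_suminf) (auto simp: less_imp_le)
    then show ?thesis by (simp add: b_eq)
  qed
  \<comment> \<open>The vertex corresponds to real part tending to minus infinity in the chart. The
    majorant \<open>Qbound\<close> is summable in \<open>j\<close> and independent of the point, so
    limit and sum may be exchanged.\<close>
  have Tlim: "((\<lambda>x::real. T n (of_real x)) \<longlongrightarrow> of_real (s n) * c n) at_bot" for n
  proof -
    have "((\<lambda>x::real. \<Sum>j. Q j n (of_real x)) \<longlongrightarrow> (\<Sum>j. of_real (b j * ?q j ^ n) * c n)) at_bot"
    proof (rule tannerys_theorem[THEN conjunct2, THEN conjunct2])
      show "((\<lambda>x::real. Q j n (of_real x)) \<longlongrightarrow> of_real (b j * ?q j ^ n) * c n) at_bot" for j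
      proof -
        have "filterlim (\<lambda>x::real. ln (?q j) + x) at_bot at_bot"
          by (simp add: filterlim_tendsto_add_at_bot_iff[OF tendsto_const] filterlim_ident)
        from filterlim_compose[OF lim[of n] this]
        show ?thesis unfolding Q_def by (intro tendsto_mult tendsto_const) simp
      qed
      show "\<forall>\<^sub>F (j, x::real) in sequentially \<times>\<^sub>F at_bot.
          norm (Q j n (of_real x)) \<le> A * H ^ n * G n * L n * (1 / 2 ^ j)"
        using Qbound[OF real_in] by (intro always_eventually) auto
    qed (rule suminf_half_power(1), simp)
    moreover have "(\<Sum>j. of_real (b j * ?q j ^ n) * c n) = of_real (s n) * c n"
      unfolding s_def suminf_of_real[OF s_summ]
      by (intro suminf_mult2[symmetric] summable_of_real s_summ)
    ultimately show ?thesis by (simp add: T_def)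
  qed
  have "ultra_class M (sector \<alpha>) \<subseteq> ultra_class N (sector \<alpha>)"
    if N: "pos_seq N" and fN: "transform L f \<in> ultra_class N (sector \<alpha>)" for N
  proof -
    have Npos: "N n > 0" for n using N by (simp add: pos_seq_def)
    obtain k K where k: "k > 0"
      and K: "\<And>z j. z \<in> sector \<alpha> \<Longrightarrow> norm ((rderiv ^^ j) (transform L f) z) / (k ^ j * N j) \<le> K"
      using fN by (auto simp: ultra_class_def bdd_above_def) blast
    have le: "norm (of_real (s n) * c n) \<le> K * (k ^ n * N n)" for n
    proof (rule tendsto_upperbound[OF tendsto_norm[OF Tlim]])
      show "\<forall>\<^sub>F x in at_bot. norm (T n (of_real x)) \<le> K * (k ^ n * N n)"
        using K[of "LogPt (of_real _)" n] k Npos[of n] derivs[OF _ real_in, of n] real_in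
        by (intro always_eventually) (simp add: rlog_in_logstrip pos_divide_le_eq)
    qed simp
    \<comment> \<open>\<open>A'\<close> and \<open>B\<close> come from the equivalence,
      \<open>a\<close> and \<open>h\<close> from \<open>lower\<close>, the factor 2 from
      \<open>s_ge\<close>, and \<open>k\<close> and \<open>K\<close> from membership in the class of
      \<open>N\<close>. The number \<open>\<bar>K\<bar> + 1\<close> makes the constant
      positive.\<close>
    have "M n \<le> (A' / a * (\<bar>K\<bar> + 1)) * (B * 2 * k / h) ^ n * N n" for n
    proof -
      have "a * h ^ n * G n * (L n / 2 ^ n) \<le> norm (c n) * s n"
        using lower[of n] s_ge[of n] ah Gpos[of n] Lpos[of n]
        by (intro mult_mono) (auto simp: less_imp_le)
      also have "\<dots> \<le> norm (of_real (s n) * c n)"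
        by (simp add: norm_mult mult.commute mult_right_mono)
      also have "\<dots> \<le> K * (k ^ n * N n)" by (rule le)
      also have "\<dots> \<le> (\<bar>K\<bar> + 1) * (k ^ n * N n)"
        using k Npos[of n] by (intro mult_right_mono) auto
      finally have 1: "a * h ^ n * (G n * L n) \<le> (\<bar>K\<bar> + 1) * (2 * k) ^ n * N n"
        by (simp add: field_simps)
      have "a * h ^ n * M n \<le> a * h ^ n * (A' * B ^ n * (G n * L n))"
        using AB(3)[of n] ah by (intro mult_left_mono) auto
      also have "\<dots> = A' * B ^ n * (a * h ^ n * (G n * L n))" by (simp add: mult_ac)
      also have "\<dots> \<le> A' * B ^ n * ((\<bar>K\<bar> + 1) * (2 * k) ^ n * N n)"
        using 1 AB by (intro mult_left_mono) auto
      finally show ?thesis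
        using ah by (simp add: field_simps)
    qed
    then show ?thesis
      by (rule ultra_class_mono) (use AB ah k pos N in auto)
  qed
  with mem show ?thesis unfolding characteristic_def by blast
qed

section \<open>Parameter integrals and bounds for the Gamma function\<close>

text \<open>Cauchy's inequality turns a local majorant of the integrand into one for its derivative,
  and hence for its difference quotients. Dominated convergence along sequences then gives the
  derivative of the integral.\<close>

lemma has_field_derivative_integral:
  fixes f :: "complex \<Rightarrow> 'a \<Rightarrow> complex"
  assumes U: "open U" and meas: "\<And>z. z \<in> U \<Longrightarrow> f z \<in> borel_measurable M"
    and holo: "\<And>x. (\<lambda>z. f z x) holomorphic_on U"
    and bound: "\<And>z0. z0 \<in> U \<Longrightarrow>
      \<exists>e>0. \<exists>B. integrable M B \<and> (\<forall>z\<in>ball z0 e \<inter> U. \<forall>x. norm (f z x) \<le> B x)"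
    and z0: "z0 \<in> U"
  shows "((\<lambda>z. \<integral>x. f z x \<partial>M) has_field_derivative (\<integral>x. deriv (\<lambda>z. f z x) z0 \<partial>M)) (at z0)"
proof -
  obtain e B where e: "e > 0" "integrable M B"
    "\<And>z x. z \<in> ball z0 e \<Longrightarrow> z \<in> U \<Longrightarrow> norm (f z x) \<le> B x"
    using bound[OF z0] by auto
  obtain d where d: "d > 0" "ball z0 d \<subseteq> U"
    using U z0 openE by blast
  \<comment> \<open>A disc of radius \<open>r\<close> around a point within \<open>r\<close> of
    \<open>z0\<close> remains both in \<open>U\<close> and in the region where \<open>B\<close> is a
    majorant.\<close>
  define r where "r = min e d / 3"
  have r: "r > 0" "2 * r < e" "2 * r < d" using e(1) d(1) by (auto simp: r_def)
  have in_U: "z \<in> U" "z \<in> ball z0 e" if "dist z0 z \<le> 2 * r" for z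
    using that r d by auto
  have deriv_le: "norm (deriv (\<lambda>z. f z x) w) \<le> B x / r" if w: "w \<in> ball z0 r" for w x
  proof -
    have sub: "cball w r \<subseteq> U"
    proof
      fix z assume "z \<in> cball w r"
      then have "dist z0 z \<le> 2 * r" using w dist_triangle[of z0 z w] by auto
      then show "z \<in> U" by (rule in_U)
    qed
    have "norm ((deriv ^^ 1) (\<lambda>z. f z x) w) \<le> fact 1 * B x / r ^ 1"
    proof (rule Cauchy_inequality)
      show "(\<lambda>z. f z x) holomorphic_on ball w r"
        by (rule holomorphic_on_subset[OF holo]) (use sub in auto)
      show "continuous_on (cball w r) (\<lambda>z. f z x)"
        by (rule holomorphic_on_imp_continuous_on[OF holomorphic_on_subset[OF holo sub]])
      show "norm (f z x) \<le> B x" if "norm (w - z) = r" for z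
      proof -
        have "dist z0 z \<le> 2 * r"
          using w that dist_triangle[of z0 z w] by (auto simp: dist_norm)
        then show ?thesis using in_U e(3) by blast
      qed
    qed (use r in auto)
    then show ?thesis by simp
  qed
  have ball_U: "ball z0 r \<subseteq> U" using in_U r by auto
  have diff: "((\<lambda>z. f z x) has_field_derivative deriv (\<lambda>z. f z x) w) (at w)" if "w \<in> U" for w x
    using holomorphic_derivI[OF holo U that] .
  have lipschitz: "norm (f z x - f z0 x) \<le> B x / r * norm (z - z0)" if "z \<in> ball z0 r" for z x
  proof (rule field_differentiable_bound[of "ball z0 r" "\<lambda>z. f z x" "deriv (\<lambda>z. f z x)"])
    show "((\<lambda>z. f z x) has_field_derivative deriv (\<lambda>z. f z x) w) (at w within ball z0 r)"
      if "w \<in> ball z0 r" for w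
      using diff ball_U that has_field_derivative_at_within by blast
  qed (use that r deriv_le in auto)
  have int: "integrable M (f z)" if "z \<in> ball z0 r" for z
  proof (rule Bochner_Integration.integrable_bound[OF e(2)])
    show "f z \<in> borel_measurable M" using meas that ball_U by blast
    have "norm (f z x) \<le> norm (B x)" for x
      using e(3)[of z x] in_U[of z] that r by auto
    then show "AE x in M. norm (f z x) \<le> norm (B x)" by simp
  qed
  let ?D = "\<integral>x. deriv (\<lambda>z. f z x) z0 \<partial>M"
  have "((\<lambda>z. ((\<integral>x. f z x \<partial>M) - (\<integral>x. f z0 x \<partial>M)) / (z - z0)) \<longlongrightarrow> ?D) (at z0 within ball z0 r)"
    unfolding tendsto_at_iff_sequentially o_def
  proof (intro allI impI)
    fix X :: "nat \<Rightarrow> complex"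
    assume X: "\<forall>i. X i \<in> ball z0 r - {z0}" "X \<longlonglongrightarrow> z0"
    let ?s = "\<lambda>n x. (f (X n) x - f z0 x) / (X n - z0)"
    have lim: "(\<lambda>n. ?s n x) \<longlonglongrightarrow> deriv (\<lambda>z. f z x) z0" for x
    proof -
      have "((\<lambda>z. (f z x - f z0 x) / (z - z0)) \<longlongrightarrow> deriv (\<lambda>z. f z x) z0) (at z0)"
        using diff[OF z0, of x] by (simp add: has_field_derivative_iff)
      moreover have "filterlim X (at z0) sequentially"
        using X by (auto simp: filterlim_at)
      ultimately show ?thesis by (rule filterlim_compose)
    qed
    have XU: "X n \<in> U" for n using X(1) ball_U by blast
    have ms: "?s n \<in> borel_measurable M" for n
      by (intro borel_measurable_divide borel_measurable_diff meas XU z0) auto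
    have "(\<lambda>n. \<integral>x. ?s n x \<partial>M) \<longlonglongrightarrow> ?D"
    proof (rule integral_dominated_convergence[of _ _ _ "\<lambda>x. B x / r"])
      show "(\<lambda>x. deriv (\<lambda>z. f z x) z0) \<in> borel_measurable M"
        by (rule borel_measurable_LIMSEQ_metric[of ?s]) (use lim ms in auto)
      show "AE x in M. norm (?s n x) \<le> B x / r" for n
        using X(1) lipschitz[of "X n"]
        by (intro AE_I2) (auto simp: norm_divide divide_simps)
    qed (use lim ms e(2) in auto)
    moreover have "(\<integral>x. ?s n x \<partial>M) = ((\<integral>x. f (X n) x \<partial>M) - (\<integral>x. f z0 x \<partial>M)) / (X n - z0)" for n
      using X(1) int[of "X n"] int[of z0] r by simp
    ultimately show "(\<lambda>n. ((\<integral>x. f (X n) x \<partial>M) - (\<integral>x. f z0 x \<partial>M)) / (X n - z0)) \<longlonglongrightarrow> ?D"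
      by (simp only:)
  qed
  moreover have "at z0 within ball z0 r = at z0"
    by (rule at_within_open) (use r in auto)
  ultimately show ?thesis by (simp only: has_field_derivative_iff)
qed

text \<open>The chain rule gives the derivative \<open>v * D\<close> along the line, where
  \<open>J\<close> is constant. This is the substitute for contour deformation: one invariant real
  direction makes a complex derivative vanish.\<close>

lemma has_field_derivative_invariant_zero:
  fixes J :: "complex \<Rightarrow> complex"
  assumes J: "(J has_field_derivative D) (at c)" and "v \<noteq> 0"
    and inv: "\<And>t::real. J (c + of_real t * v) = J c"
  shows "D = 0"
proof -
  have "((\<lambda>t::real. c + of_real t * v) has_vector_derivative v) (at 0)"
    by (auto intro!: derivative_eq_intros)
  then have "((J \<circ> (\<lambda>t::real. c + of_real t * v)) has_vector_derivative v * D) (at 0)"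
    by (rule field_vector_diff_chain_at) (use J in simp)
  moreover have "J \<circ> (\<lambda>t::real. c + of_real t * v) = (\<lambda>_. J c)"
    using inv by auto
  ultimately have "v * D = 0"
    using vector_derivative_unique_at[OF _ has_vector_derivative_const] by metis
  with \<open>v \<noteq> 0\<close> show ?thesis by simp
qed

section \<open>Euler's integral and bounds of Stirling type\<close>

text \<open>Euler's integral after the substitution of \<open>k * t\<close> for
  \<open>t\<close>.\<close>

lemma has_bochner_integral_Gamma:
  fixes s k :: real
  assumes "s > -1" "k > 0"
  shows "has_bochner_integral lborel (\<lambda>t. indicator {0<..} t * (t powr s * exp (- k * t)))
    (Gamma (s + 1) / k powr (s + 1))"
proof -
  have "has_bochner_integral lborel (\<lambda>t. indicator {0<..} t * (t powr s * exp (- t))) (Gamma (s + 1))"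
  proof (rule has_bochner_integral_nn_integral)
    have "(\<integral>\<^sup>+t. ennreal (indicator {0<..} t * (t powr s * exp (- t))) \<partial>lborel) =
        (\<integral>\<^sup>+t. ennreal (indicator {0..} t * t powr (s + 1 - 1) / exp t) \<partial>lborel)"
      by (intro nn_integral_cong) (auto simp: indicator_def exp_minus field_simps)
    then show "(\<integral>\<^sup>+t. ennreal (indicator {0<..} t * (t powr s * exp (- t))) \<partial>lborel) = ennreal (Gamma (s + 1))"
      using Gamma_conv_nn_integral_real[of "s + 1"] assms by simp
  qed (use assms in \<open>auto intro!: less_imp_le Gamma_real_pos\<close>)
  then have "has_bochner_integral lborel
      (\<lambda>t. indicator {0<..} (0 + k * t) * ((0 + k * t) powr s * exp (- (0 + k * t)))) (Gamma (s + 1) /\<^sub>R \<bar>k\<bar>)"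
    by (subst (asm) lborel_has_bochner_integral_real_affine_iff[of k _ _ 0]) (use assms in auto)
  then have "has_bochner_integral lborel
      (\<lambda>t. inverse (k powr s) * (indicator {0<..} (0 + k * t) * ((0 + k * t) powr s * exp (- (0 + k * t)))))
      (inverse (k powr s) * (Gamma (s + 1) /\<^sub>R \<bar>k\<bar>))"
    by (rule has_bochner_integral_mult_right)
  moreover have "(\<lambda>t. inverse (k powr s) * (indicator {0<..} (0 + k * t) * ((0 + k * t) powr s * exp (- (0 + k * t)))))
      = (\<lambda>t. indicator {0<..} t * (t powr s * exp (- k * t)))"
    using assms by (auto simp: fun_eq_iff indicator_def powr_mult zero_less_mult_iff field_simps)
  moreover have "inverse (k powr s) * (Gamma (s + 1) /\<^sub>R \<bar>k\<bar>) = Gamma (s + 1) / k powr (s + 1)"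
    using assms by (simp add: powr_add field_simps)
  ultimately show ?thesis by simp
qed

lemma has_bochner_integral_mono:
  fixes f g :: "'a \<Rightarrow> real"
  assumes "has_bochner_integral M f a" "has_bochner_integral M g b" "\<And>x. f x \<le> g x"
  shows "a \<le> b"
  using integral_mono[of M f g] assms by (simp add: has_bochner_integral_iff)

text \<open>Only the part of Euler's integral beyond \<open>x\<close> is kept. With the variable
  \<open>x + u\<close> the power is at least \<open>x powr x\<close>, and the remaining integral of
  \<open>exp (- u)\<close> is 1.\<close>

lemma Gamma_plus1_ge:
  fixes x :: real
  assumes "x > 0"
  shows "x powr x * exp (- x) \<le> Gamma (x + 1)"
proof -
  note I = has_bochner_integral_Gamma[of _ 1, simplified]
  have "has_bochner_integral lborel (\<lambda>u. indicator {0<..} (x + 1 * u) * ((x + 1 * u) powr x * exp (- (x + 1 * u))))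
      (Gamma (x + 1) /\<^sub>R \<bar>1\<bar>)"
    using assms
    by (intro lborel_has_bochner_integral_real_affine_iff[of 1 _ _ x, THEN iffD1] I[of x]) auto
  then have 1: "has_bochner_integral lborel (\<lambda>u. indicator {0<..} (x + u) * ((x + u) powr x * exp (- (x + u))))
      (Gamma (x + 1))" by simp
  have "has_bochner_integral lborel (\<lambda>u. x powr x * exp (- x) * (indicator {0<..} u * (u powr 0 * exp (- u))))
      (x powr x * exp (- x) * Gamma (0 + 1))"
    using I[of 0] by (intro has_bochner_integral_mult_right) auto
  then have "x powr x * exp (- x) * Gamma (0 + 1) \<le> Gamma (x + 1)"
  proof (rule has_bochner_integral_mono[OF _ 1])
    fix u :: real
    show "x powr x * exp (- x) * (indicator {0<..} u * (u powr 0 * exp (- u)))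
       \<le> indicator {0<..} (x + u) * ((x + u) powr x * exp (- (x + u)))"
      using assms by (auto simp: indicator_def exp_diff exp_minus field_simps intro!: powr_mono2)
  qed
  then show ?thesis by simp
qed

text \<open>Half of the exponential is kept for integration and contributes the factor 2. The rest,
  \<open>t powr x * exp (- t / 2)\<close>, is largest at \<open>t = 2 * x\<close>.\<close>

lemma Gamma_plus1_le:
  fixes x :: real
  assumes "x > 0"
  shows "Gamma (x + 1) \<le> 2 * ((2 * x) powr x * exp (- x))"
proof -
  have 1: "has_bochner_integral lborel (\<lambda>t. indicator {0<..} t * (t powr x * exp (- 1 * t)))
    (Gamma (x + 1) / 1 powr (x + 1))" by (rule has_bochner_integral_Gamma) (use assms in auto)
  have "has_bochner_integral lborel (\<lambda>t. (2 * x) powr x * exp (- x) *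
        (indicator {0<..} t * (t powr 0 * exp (- (1/2) * t))))
      ((2 * x) powr x * exp (- x) * (Gamma (0 + 1) / (1/2) powr (0 + 1)))"
    by (intro has_bochner_integral_mult_right has_bochner_integral_Gamma) auto
  with 1 have "Gamma (x + 1) / 1 powr (x + 1) \<le> (2 * x) powr x * exp (- x) * (Gamma (0 + 1) / (1/2) powr (0 + 1))"
  proof (rule has_bochner_integral_mono)
    fix t :: real
    show "indicator {0<..} t * (t powr x * exp (- 1 * t)) \<le>
       (2 * x) powr x * exp (- x) * (indicator {0<..} t * (t powr 0 * exp (- (1/2) * t)))"
    proof (cases "t > 0")
      case True
      \<comment> \<open>The tangent inequality of the logarithm at 1 encodes the maximum at
        \<open>t = 2 * x\<close>.\<close>
      have "ln (t / (2 * x)) \<le> t / (2 * x) - 1"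
        using True assms by (intro ln_le_minus_one) simp
      then have "x * ln (t / (2 * x)) \<le> x * (t / (2 * x) - 1)"
        using assms by (intro mult_left_mono) auto
      also have "\<dots> = t / 2 - x" using assms by (simp add: field_simps)
      finally have "x * ln t - t \<le> x * ln (2 * x) - x - t / 2"
        using True assms by (simp add: ln_div algebra_simps)
      then show ?thesis
        using True assms by (simp add: powr_def mult_exp_exp)
    qed simp
  qed
  then show ?thesis by simp
qed

section \<open>The case \<open>\<alpha> > 1\<close>\<close>

lemma Gbar_one: "Gbar \<beta> (\<lambda>_. 1) n = (if n = 0 then 1 else real n powr (\<beta> * real n))"
  by (simp add: Gbar_def)

lemma powr_power_mult: "t > 0 \<Longrightarrow> (t powr b) ^ n = t powr (b * real n)"
  for t b :: real
  by (simp add: powr_powr flip: powr_realpow)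

text \<open>\<open>Gbar \<beta> (\<lambda>_. 1) n\<close> is the pure weight n^(\<beta> n). With
  \<open>Gamma_ge_Gbar\<close> this identifies Gamma values with it up to geometric factors, which
  the classes do not see.\<close>

lemma Gamma_le_Gbar:
  assumes "\<beta> > 0"
  shows "Gamma (\<beta> * real n + 1) \<le> 2 * ((2 * \<beta>) powr \<beta>) ^ n * Gbar \<beta> (\<lambda>_. 1) n"
proof (cases "n = 0")
  case False
  have "Gamma (\<beta> * real n + 1) \<le> 2 * ((2 * (\<beta> * real n)) powr (\<beta> * real n) * exp (- (\<beta> * real n)))"
    by (rule Gamma_plus1_le) (use assms False in auto)
  also have "\<dots> \<le> 2 * ((2 * (\<beta> * real n)) powr (\<beta> * real n) * 1)"
    using assms by (intro mult_left_mono) auto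
  also have "\<dots> = 2 * ((2 * \<beta>) powr \<beta>) ^ n * Gbar \<beta> (\<lambda>_. 1) n"
    using assms False by (simp add: Gbar_one powr_power_mult powr_mult power_mult_distrib)
  finally show ?thesis .
qed (simp add: Gbar_one)

lemma Gamma_ge_Gbar:
  assumes "\<beta> > 0"
  shows "((\<beta> / exp 1) powr \<beta>) ^ n * Gbar \<beta> (\<lambda>_. 1) n \<le> Gamma (\<beta> * real n + 1)"
proof (cases "n = 0")
  case False
  have "(\<beta> * real n) powr (\<beta> * real n) * exp (- (\<beta> * real n)) \<le> Gamma (\<beta> * real n + 1)"
    by (rule Gamma_plus1_ge) (use assms False in auto)
  also have "(\<beta> * real n) powr (\<beta> * real n) * exp (- (\<beta> * real n))
      = ((\<beta> / exp 1) powr \<beta>) ^ n * Gbar \<beta> (\<lambda>_. 1) n"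
    using assms False
    by (simp add: Gbar_one powr_power_mult powr_mult powr_divide exp_powr_real exp_minus exp_of_nat2_mult field_simps)
  finally show ?thesis .
qed (simp add: Gbar_one)

section \<open>Ray integrals with a complex direction parameter\<close>

lemma Re_exp_pos: "\<bar>Im z\<bar> < pi / 2 \<Longrightarrow> Re (exp z) > 0"
  by (auto simp: Re_exp intro!: mult_pos_pos cos_gt_zero_pi)

text \<open>The integrand of the \<open>n\<close>-th derivative of \<open>g\<close> at \<open>exp w\<close>, up to the sign \<open>(-1)^n\<close>, along the ray
  \<open>v = t * exp p\<close>.  Complex values of \<open>p\<close> are allowed: a real shift of \<open>p\<close> rescales the ray.\<close>

definition gker :: "real \<Rightarrow> nat \<Rightarrow> complex \<Rightarrow> complex \<Rightarrow> real \<Rightarrow> complex" where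
  "gker \<beta> n w p t = of_real (indicator {0<..} t) * (of_real (t powr \<beta>) * exp (of_real \<beta> * p)) ^ n *
     exp (p - exp (w + of_real \<beta> * p) * of_real (t powr \<beta>) - of_real t * exp p)"

definition gint :: "real \<Rightarrow> nat \<Rightarrow> complex \<Rightarrow> complex \<Rightarrow> complex" where
  "gint \<beta> n w p = (\<integral>t. gker \<beta> n w p t \<partial>lborel)"

lemma gker_measurable [measurable]: "gker \<beta> n w p \<in> borel_measurable lborel"
  unfolding gker_def by measurable

text \<open>Under the assumption the factor with \<open>t powr \<beta>\<close> in its exponent has
  modulus at most 1, so the decay comes from \<open>exp (- v)\<close> alone.\<close>

lemma norm_gker_le:
  assumes "Re (exp (w + of_real \<beta> * p)) \<ge> 0"
  shows "norm (gker \<beta> n w p t) \<le>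
    exp (Re p * (\<beta> * real n + 1)) * (indicator {0<..} t * (t powr (\<beta> * real n) * exp (- Re (exp p) * t)))"
proof (cases "t > 0")
  case True
  have "norm (gker \<beta> n w p t) = t powr (\<beta> * real n) * exp (\<beta> * Re p) ^ n *
      exp (Re p - Re (exp (w + of_real \<beta> * p)) * t powr \<beta> - t * Re (exp p))"
    using True by (simp add: gker_def norm_mult norm_power power_mult_distrib powr_power_mult)
  also have "\<dots> \<le> t powr (\<beta> * real n) * exp (\<beta> * Re p) ^ n * exp (Re p - t * Re (exp p))"
    using assms by (intro mult_left_mono) auto
  also have "exp (\<beta> * Re p) ^ n = exp (real n * (\<beta> * Re p))"
    by (simp add: exp_of_nat_mult)
  also have "t powr (\<beta> * real n) * exp (real n * (\<beta> * Re p)) * exp (Re p - t * Re (exp p)) =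
      exp (Re p * (\<beta> * real n + 1)) * (t powr (\<beta> * real n) * exp (- Re (exp p) * t))"
    by (simp add: algebra_simps flip: exp_add)
  finally show ?thesis using True by simp
qed (simp add: gker_def)

lemma gker_holomorphic_angle: "(\<lambda>p. gker \<beta> n w p t) holomorphic_on U"
  unfolding gker_def by (intro holomorphic_intros)

lemma gker_scale: "gker \<beta> n w (p + of_real s) t = of_real (exp s) * gker \<beta> n w p (exp s * t)"
proof (cases "t > 0")
  case True
  have "(exp s * t) powr \<beta> = exp (\<beta> * s) * t powr \<beta>"
    using True by (simp add: powr_mult exp_powr_real mult.commute)
  then show ?thesis
    using True unfolding gker_def
    by (simp add: algebra_simps exp_add exp_diff exp_of_real zero_less_mult_iff flip: of_real_mult)
      (simp add: exp_of_real[symmetric] exp_add exp_diff algebra_simps)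
qed (simp add: gker_def zero_less_mult_iff)

lemma gint_scale: "gint \<beta> n w (p + of_real s) = gint \<beta> n w p"
proof -
  have "gint \<beta> n w p = \<bar>exp s\<bar> *\<^sub>R (\<integral>t. gker \<beta> n w p (0 + exp s * t) \<partial>lborel)"
    unfolding gint_def by (rule lborel_integral_real_affine) simp
  then show ?thesis unfolding gint_def gker_scale by (simp add: scaleR_conv_of_real)
qed

text \<open>With z = \<open>exp w\<close> and v = \<open>t * exp p\<close>, the two conditions say
  that z v^\<beta> and v both have argument below \<pi>/2 in modulus, so both exponentials decay
  along the ray.\<close>

definition gdom :: "real \<Rightarrow> complex \<Rightarrow> complex set" where
  "gdom \<beta> w = {p. \<bar>Im w + \<beta> * Im p\<bar> < pi / 2 \<and> \<bar>Im p\<bar> < pi / 2}"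

lemma open_gdom: "open (gdom \<beta> w)"
  unfolding gdom_def by (intro open_Collect_conj open_Collect_less continuous_intros)

lemma convex_gdom: "convex (gdom \<beta> w)"
proof -
  have "gdom \<beta> w = {p. Im p < pi / 2} \<inter> {p. Im p > - pi / 2} \<inter>
      {p. inner (Complex 0 \<beta>) p < pi / 2 - Im w} \<inter> {p. inner (Complex 0 \<beta>) p > - pi / 2 - Im w}"
    unfolding gdom_def inner_complex_def abs_less_iff
    by (intro set_eqI) (simp, linarith)
  then show ?thesis
    by (simp only:) (intro convex_Int convex_halfspace_lt convex_halfspace_gt
        convex_halfspace_Im_lt convex_halfspace_Im_gt)
qed

lemma gdom_Re:
  assumes "p \<in> gdom \<beta> w"
  shows "Re (exp (w + of_real \<beta> * p)) > 0" "Re (exp p) > 0"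
  using assms by (auto simp: gdom_def intro!: Re_exp_pos)

lemma integrable_Gamma_kernel:
  "s > -1 \<Longrightarrow> k > 0 \<Longrightarrow> integrable lborel (\<lambda>t::real. indicator {0<..} t * (t powr s * exp (- k * t)))"
  using has_bochner_integral_Gamma integrable.intros by blast

text \<open>The integral is holomorphic in \<open>p\<close>, and real shifts of \<open>p\<close>
  only rescale the variable of integration. Its derivative therefore vanishes on the convex set
  \<open>gdom \<beta> w\<close>.\<close>

lemma gint_angle_indep:
  assumes \<beta>: "\<beta> > 0" and p: "p \<in> gdom \<beta> w" and q: "q \<in> gdom \<beta> w"
  shows "gint \<beta> n w p = gint \<beta> n w q"
proof -
  have deriv: "(gint \<beta> n w has_field_derivative (\<integral>t. deriv (\<lambda>p. gker \<beta> n w p t) p0 \<partial>lborel)) (at p0)"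
    if p0: "p0 \<in> gdom \<beta> w" for p0
    unfolding gint_def
  proof (rule has_field_derivative_integral[OF open_gdom _ gker_holomorphic_angle _ p0])
    fix p0 assume p0: "p0 \<in> gdom \<beta> w"
    \<comment> \<open>Half of the decay rate at \<open>p0\<close> remains a lower bound for the
      decay rate near \<open>p0\<close>. Capping the radius at 1 keeps \<open>Re p\<close> below
      \<open>Re p0 + 1\<close>, so the majorant is independent of \<open>p\<close>.\<close>
    define k where "k = Re (exp p0) / 2"
    have k: "k > 0" using gdom_Re[OF p0] by (simp add: k_def)
    have "((\<lambda>p. Re (exp p)) \<longlongrightarrow> Re (exp p0)) (at p0)" by (intro tendsto_intros)
    moreover have "k < Re (exp p0)" using k by (simp add: k_def)
    ultimately have "\<forall>\<^sub>F p in at p0. k < Re (exp p)"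
      by (rule order_tendstoD(1))
    then obtain d where d: "d > 0" "\<And>p. p \<noteq> p0 \<Longrightarrow> dist p p0 < d \<Longrightarrow> k < Re (exp p)"
      by (auto simp: eventually_at)
    have dk: "k < Re (exp p)" if "dist p p0 < d" for p
      using d(2)[of p] that k by (cases "p = p0") (auto simp: k_def)
    let ?B = "\<lambda>t. exp ((Re p0 + 1) * (\<beta> * real n + 1)) *
      (indicator {0<..} t * (t powr (\<beta> * real n) * exp (- k * t)))"
    have "norm (gker \<beta> n w p t) \<le> ?B t" if "p \<in> ball p0 (min d 1) \<inter> gdom \<beta> w" for p t
    proof -
      have "Re p \<le> Re p0 + 1"
        using that abs_Re_le_cmod[of "p - p0"] by (auto simp: dist_norm norm_minus_commute)
      then have "exp (Re p * (\<beta> * real n + 1)) \<le> exp ((Re p0 + 1) * (\<beta> * real n + 1))"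
        using \<beta> by (simp add: mult_right_mono)
      moreover have "indicator {0<..} t * (t powr (\<beta> * real n) * exp (- Re (exp p) * t)) \<le>
          indicator {0<..} t * (t powr (\<beta> * real n) * exp (- k * t))"
        using dk[of p] that by (auto simp: indicator_def dist_commute)
      ultimately have "exp (Re p * (\<beta> * real n + 1)) *
          (indicator {0<..} t * (t powr (\<beta> * real n) * exp (- Re (exp p) * t))) \<le> ?B t"
        by (rule mult_mono) auto
      then show ?thesis
        using norm_gker_le[of w \<beta> p n t] gdom_Re[of p \<beta> w] that by auto
    qed
    moreover have "integrable lborel ?B"
      using \<beta> k by (intro integrable_mult_right integrable_Gamma_kernel) (auto intro: less_le_trans[of _ 0])
    ultimately show "\<exists>e>0. \<exists>B. integrable lborel B \<and>
        (\<forall>p\<in>ball p0 e \<inter> gdom \<beta> w. \<forall>t. norm (gker \<beta> n w p t) \<le> B t)"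
      using d(1) by (intro exI[of _ "min d 1"] conjI exI[of _ ?B]) auto
  qed simp
  have "(gint \<beta> n w has_field_derivative 0) (at p0)" if p0: "p0 \<in> gdom \<beta> w" for p0
    using has_field_derivative_invariant_zero[OF deriv[OF p0], of 1] deriv[OF p0]
    by (simp add: gint_scale)
  then have "(gint \<beta> n w has_field_derivative 0) (at p0 within gdom \<beta> w)" if "p0 \<in> gdom \<beta> w" for p0
    using that has_field_derivative_at_within by blast
  from has_field_derivative_zero_constant[OF convex_gdom this]
  obtain c where "\<And>p. p \<in> gdom \<beta> w \<Longrightarrow> gint \<beta> n w p = c" by blast
  then show ?thesis using p q by simp
qed

text \<open>For a fixed direction, differentiating the kernel in \<open>w\<close> brings out
  \<open>- exp w\<close> and one more factor v^\<beta>, which raises \<open>n\<close> by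
  one.\<close>

lemma gint_has_field_derivative:
  assumes \<beta>: "\<beta> > 0" and p: "p \<in> gdom \<beta> w"
  shows "((\<lambda>w. gint \<beta> n w p) has_field_derivative - (exp w * gint \<beta> (Suc n) w p)) (at w)"
proof -
  let ?U = "{w. \<bar>Im w + \<beta> * Im p\<bar> < pi / 2}"
  have U: "open ?U" by (intro open_Collect_less continuous_intros)
  have w: "w \<in> ?U" and p': "\<bar>Im p\<bar> < pi / 2" using p by (auto simp: gdom_def)
  have "((\<lambda>w. gint \<beta> n w p) has_field_derivative (\<integral>t. deriv (\<lambda>w. gker \<beta> n w p t) w \<partial>lborel)) (at w)"
    unfolding gint_def
  proof (rule has_field_derivative_integral[OF U _ _ _ w])
    show "(\<lambda>w. gker \<beta> n w p t) holomorphic_on ?U" for t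
      unfolding gker_def by (intro holomorphic_intros)
    let ?B = "\<lambda>t. exp (Re p * (\<beta> * real n + 1)) *
      (indicator {0<..} t * (t powr (\<beta> * real n) * exp (- Re (exp p) * t)))"
    have "integrable lborel ?B"
      using \<beta> Re_exp_pos[OF p'] by (intro integrable_mult_right integrable_Gamma_kernel)
        (auto intro: less_le_trans[of _ 0])
    moreover have "norm (gker \<beta> n w p t) \<le> ?B t" if "w \<in> ?U" for w t
      using that p' by (intro norm_gker_le less_imp_le[OF gdom_Re(1)]) (simp add: gdom_def)
    ultimately show "\<exists>e>0. \<exists>B. integrable lborel B \<and>
        (\<forall>w\<in>ball w0 e \<inter> ?U. \<forall>t. norm (gker \<beta> n w p t) \<le> B t)" for w0
      by (intro exI[of _ 1] conjI exI[of _ ?B]) auto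
  qed simp
  moreover have "deriv (\<lambda>w. gker \<beta> n w p t) w = - exp w * gker \<beta> (Suc n) w p t" for t
    by (rule DERIV_imp_deriv)
      (auto simp: gker_def exp_add intro!: derivative_eq_intros)
  ultimately show ?thesis by (simp add: gint_def)
qed

text \<open>For \<open>Re p = 0\<close> the variable \<open>t\<close> is the modulus of v, and the
  kernel is dominated by an Euler integrand with rate \<open>k\<close>.\<close>

lemma norm_gint_le:
  assumes \<beta>: "\<beta> > 0" and p: "p \<in> gdom \<beta> w" "Re p = 0" and k: "0 < k" "k \<le> Re (exp p)"
  shows "norm (gint \<beta> n w p) \<le> Gamma (\<beta> * real n + 1) / k powr (\<beta> * real n + 1)"
proof -
  note I = has_bochner_integral_Gamma[of "\<beta> * real n" k]
  have "norm (gint \<beta> n w p) \<le> (\<integral>t. indicator {0<..} t * (t powr (\<beta> * real n) * exp (- k * t)) \<partial>lborel)"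
    unfolding gint_def
  proof (rule order_trans[OF integral_norm_bound integral_mono'])
    show "integrable lborel (\<lambda>t. indicator {0<..} t * (t powr (\<beta> * real n) * exp (- k * t)))"
      using \<beta> k by (intro integrable_Gamma_kernel) (auto intro: less_le_trans[of _ 0])
    fix t :: real
    have "norm (gker \<beta> n w p t) \<le> indicator {0<..} t * (t powr (\<beta> * real n) * exp (- Re (exp p) * t))"
      using norm_gker_le[of w \<beta> p n t] gdom_Re[OF p(1)] p(2) by simp
    also have "\<dots> \<le> indicator {0<..} t * (t powr (\<beta> * real n) * exp (- k * t))"
      using k by (auto simp: indicator_def)
    finally show "norm (gker \<beta> n w p t) \<le> indicator {0<..} t * (t powr (\<beta> * real n) * exp (- k * t))" .
  qed simp
  also have "\<dots> = Gamma (\<beta> * real n + 1) / k powr (\<beta> * real n + 1)"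
    using I \<beta> k by (intro has_bochner_integral_integral_eq I) (auto intro: less_le_trans[of _ 0])
  finally show ?thesis .
qed

text \<open>As z tends to 0 along the positive axis, the factor exp (-z t^\<beta>) tends to 1 and
  Euler's integral is left. Its integrand is also the majorant.\<close>

lemma gint_tendsto:
  assumes \<beta>: "\<beta> > 0"
  shows "((\<lambda>x::real. gint \<beta> n (of_real x) 0) \<longlongrightarrow> of_real (Gamma (\<beta> * real n + 1))) at_bot"
proof -
  let ?B = "\<lambda>t. indicator {0<..} t * (t powr (\<beta> * real n) * exp (- 1 * t)) :: real"
  have B: "has_bochner_integral lborel ?B (Gamma (\<beta> * real n + 1) / 1 powr (\<beta> * real n + 1))"
    by (rule has_bochner_integral_Gamma) (use \<beta> in \<open>auto intro: less_le_trans[of _ 0]\<close>)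
  have "((\<lambda>x. \<integral>t. gker \<beta> n (of_real (- x)) 0 t \<partial>lborel) \<longlongrightarrow> (\<integral>t. of_real (?B t) \<partial>lborel)) at_top"
  proof (rule integral_dominated_convergence_at_top[where w = ?B])
    show "AE t in lborel. ((\<lambda>x. gker \<beta> n (of_real (- x)) 0 t) \<longlongrightarrow> of_real (?B t)) at_top"
    proof (rule AE_I2)
      fix t :: real
      have "((\<lambda>x. of_real (indicator {0<..} t) * (of_real (t powr \<beta>)) ^ n *
          exp (of_real (- exp (- x) * t powr \<beta> - t))) \<longlongrightarrow> of_real (indicator {0<..} t) * (of_real (t powr \<beta>)) ^ n *
          (exp (of_real (- 0 * t powr \<beta> - t)) :: complex)) at_top"
        by (intro tendsto_intros filterlim_compose[OF exp_at_bot] filterlim_uminus_at_bot_at_top)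
      moreover have "gker \<beta> n (of_real (- x)) 0 t = of_real (indicator {0<..} t) * (of_real (t powr \<beta>)) ^ n *
          exp (of_real (- exp (- x) * t powr \<beta> - t))" for x
        by (simp add: gker_def flip: exp_of_real)
      moreover have "of_real (?B t) = of_real (indicator {0<..} t) * (of_real (t powr \<beta>)) ^ n *
          (exp (of_real (- 0 * t powr \<beta> - t)) :: complex)"
        by (cases "t > 0") (simp_all add: powr_power_mult flip: of_real_power exp_of_real)
      ultimately show "((\<lambda>x. gker \<beta> n (of_real (- x)) 0 t) \<longlongrightarrow> of_real (?B t)) at_top"
        by (simp only:)
    qed
    show "\<forall>\<^sub>F x in at_top. AE t in lborel. norm (gker \<beta> n (of_real (- x)) 0 t) \<le> ?B t"
      using norm_gker_le[of "of_real (- _)" \<beta> 0 n] by (intro always_eventually allI AE_I2) (simp add: Re_exp)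
  qed (use B in \<open>auto simp: has_bochner_integral_iff\<close>)
  then show ?thesis
    using B unfolding integral_complex_of_real
    by (simp add: filterlim_at_bot_mirror gint_def has_bochner_integral_iff)
qed

section \<open>The function g on the sector\<close>

text \<open>The angle selected by \<open>SOME\<close> is admissible once one exists, and
  independence of the direction then replaces it by any convenient \<open>p\<close>.\<close>

lemma g_fun_eq_gint:
  assumes \<alpha>: "1 < \<alpha>" "\<alpha> < \<alpha>'" and p: "p \<in> gdom (\<alpha>' - 1) w"
    and ex: "\<exists>\<phi>. admissible_angle \<alpha> \<alpha>' (LogPt w) \<phi>"
  shows "g_fun \<alpha> \<alpha>' (LogPt w) = gint (\<alpha>' - 1) 0 w p"
proof -
  define \<phi> where "\<phi> = (SOME \<phi>. admissible_angle \<alpha> \<alpha>' (LogPt w) \<phi>)"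
  define \<beta> where "\<beta> = \<alpha>' - 1"
  have "admissible_angle \<alpha> \<alpha>' (LogPt w) \<phi>" unfolding \<phi>_def by (rule someI_ex[OF ex])
  then have \<phi>: "\<bar>\<phi>\<bar> < (\<alpha> - 1) / \<beta> * (pi / 2)" "\<bar>Im w - \<beta> * \<phi>\<bar> < pi / 2"
    by (auto simp: admissible_angle_def rarg_def \<beta>_def)
  have "(\<alpha> - 1) / \<beta> * (pi / 2) \<le> 1 * (pi / 2)"
    using \<alpha> by (intro mult_right_mono) (auto simp: \<beta>_def)
  with \<phi> have \<phi>2: "\<bar>\<phi>\<bar> < pi / 2" by linarith
  \<comment> \<open>The ray arg v = -\<phi>. As \<open>\<bar>\<phi>\<bar> < pi / 2\<close>, the
    principal logarithm of v is \<open>ln t + q\<close>, so \<open>powr\<close> agrees with the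
    branch used in \<open>gker\<close>.\<close>
  define q where "q = - \<i> * of_real \<phi>"
  have q: "q \<in> gdom \<beta> w" using \<phi> \<phi>2 by (simp add: gdom_def q_def)
  have pw: "(of_real t * cis (- \<phi>)) powr of_real \<beta> = of_real (t powr \<beta>) * exp (of_real \<beta> * q)" if "t > 0" for t
  proof -
    have v: "of_real t * cis (- \<phi>) = exp (of_real (ln t) + q)"
      using that by (simp add: exp_add exp_of_real cis_conv_exp q_def exp_diff exp_minus field_simps)
    have "Ln (of_real t * cis (- \<phi>)) = of_real (ln t) + q"
      unfolding v by (rule Ln_exp) (use \<phi>2 in \<open>auto simp: q_def\<close>)
    then show ?thesis
      using that by (simp add: powr_def exp_add algebra_simps flip: exp_of_real)
  qed
  have "g_fun \<alpha> \<alpha>' (LogPt w) = gint \<beta> 0 w q"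
    unfolding g_fun_def \<phi>_def[symmetric] ray_integral_def gint_def set_lebesgue_integral_def
  proof (rule Bochner_Integration.integral_cong[OF refl])
    fix t :: real
    show "indicator {0<..} t *\<^sub>R (exp (- (coord (LogPt w) * (of_real t * cis (- \<phi>)) powr of_real (\<alpha>' - 1))) *
        exp (- (of_real t * cis (- \<phi>))) * cis (- \<phi>)) = gker \<beta> 0 w q t"
    proof (cases "t > 0")
      case True
      have c: "cis (- \<phi>) = exp q" by (simp add: q_def cis_conv_exp)
      show ?thesis
        unfolding \<beta>_def[symmetric] pw[OF True]
        using True by (simp add: gker_def coord_def c exp_add exp_diff exp_minus field_simps)
    qed (simp add: gker_def)
  qed
  also have "\<dots> = gint \<beta> 0 w p"
    by (rule gint_angle_indep) (use \<alpha> p q in \<open>auto simp: \<beta>_def\<close>)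
  finally show ?thesis by (simp add: \<beta>_def)
qed

proposition characteristic_g:
  assumes \<alpha>: "1 < \<alpha>" "\<alpha> < \<alpha>'" and M: "pos_seq M" and L: "log_convex L"
    and equiv: "seq_equiv M (\<lambda>n. Gbar (\<alpha>' - 1) (\<lambda>_. 1) n * L n)"
  shows "characteristic (transform L (g_fun \<alpha> \<alpha>')) M (sector \<alpha>)"
proof -
  define \<beta> where "\<beta> = \<alpha>' - 1"
  have \<beta>: "\<beta> > 0" "\<alpha> - 1 < \<beta>" using \<alpha> by (auto simp: \<beta>_def)
  \<comment> \<open>An angle proportional to \<open>Im w\<close>, chosen so that
    \<open>Im w - \<beta> * \<phi> w = Im w / \<alpha>\<close>. Both admissibility conditions then
    follow from \<open>\<bar>Im w\<bar> < \<alpha> * pi / 2\<close>, and the decay rate cos (\<phi>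
    w) is at least the positive number \<open>k\<close> on the whole sector.\<close>
  define \<phi> where "\<phi> w = (\<alpha> - 1) / \<beta> * (Im w / \<alpha>)" for w
  define p where "p w = - \<i> * of_real (\<phi> w)" for w
  define F where "F n w = (-1) ^ n * gint \<beta> n w (p w)" for n w
  define k where "k = cos ((\<alpha> - 1) / \<beta> * (pi / 2))"
  have ang: "\<bar>\<phi> w\<bar> < (\<alpha> - 1) / \<beta> * (pi / 2)" "\<bar>Im w - \<beta> * \<phi> w\<bar> < pi / 2" if "w \<in> logstrip \<alpha>" for w
  proof -
    have w: "\<bar>Im w / \<alpha>\<bar> < pi / 2"
      using that \<alpha> by (simp add: logstrip_def pos_divide_less_eq mult.commute)
    have "\<bar>\<phi> w\<bar> = (\<alpha> - 1) / \<beta> * \<bar>Im w / \<alpha>\<bar>"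
      using \<alpha> \<beta> by (simp add: \<phi>_def abs_mult)
    then show "\<bar>\<phi> w\<bar> < (\<alpha> - 1) / \<beta> * (pi / 2)"
      using w \<alpha> \<beta> by (metis mult_strict_left_mono diff_gt_0_iff_gt divide_pos_pos)
    have "Im w - \<beta> * \<phi> w = Im w / \<alpha>"
      using \<alpha> \<beta> by (simp add: \<phi>_def field_simps)
    then show "\<bar>Im w - \<beta> * \<phi> w\<bar> < pi / 2" using w by simp
  qed
  have le: "(\<alpha> - 1) / \<beta> * (pi / 2) < 1 * (pi / 2)"
    using \<alpha> \<beta> by (intro mult_strict_right_mono) auto
  have k: "0 < k" unfolding k_def
    using \<alpha> \<beta> le by (intro cos_gt_zero_pi) (auto intro: less_le_trans[of _ 0])
  have p_dom: "p w \<in> gdom \<beta> w" if "w \<in> logstrip \<alpha>" for w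
    using ang[OF that] less_trans[OF ang(1)[OF that] le] by (simp add: gdom_def p_def)
  have k_le: "k \<le> Re (exp (p w))" if "w \<in> logstrip \<alpha>" for w
  proof -
    have "(\<alpha> - 1) / \<beta> * (pi / 2) \<le> pi" using le pi_gt_zero by linarith
    then have "cos ((\<alpha> - 1) / \<beta> * (pi / 2)) \<le> cos \<bar>\<phi> w\<bar>"
      by (intro cos_monotone_0_pi_le less_imp_le[OF ang(1)[OF that]]) simp_all
    then show ?thesis by (simp add: k_def p_def Re_exp)
  qed
  have open_dom: "open {w. p w0 \<in> gdom \<beta> w}" for w0
    unfolding gdom_def by (simp, intro open_Collect_conj open_Collect_less continuous_intros)
  have tower: "deriv_tower (logstrip \<alpha>) F"
    unfolding deriv_tower_def
  proof (intro allI ballI)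
    fix n w0 assume w0: "w0 \<in> logstrip \<alpha>"
    have "((\<lambda>w. (-1) ^ n * gint \<beta> n w (p w0)) has_field_derivative
        (-1) ^ n * - (exp w0 * gint \<beta> (Suc n) w0 (p w0))) (at w0)"
      by (intro DERIV_cmult gint_has_field_derivative \<beta> p_dom w0)
    then have "(F n has_field_derivative (-1) ^ n * - (exp w0 * gint \<beta> (Suc n) w0 (p w0))) (at w0)"
    proof (rule has_field_derivative_transform_within_open)
      show "open (logstrip \<alpha> \<inter> {w. p w0 \<in> gdom \<beta> w})"
        by (intro open_Int open_logstrip open_dom)
    qed (use w0 p_dom in \<open>auto simp: F_def intro!: gint_angle_indep \<beta>\<close>)
    then show "(F n has_field_derivative exp w0 * F (Suc n) w0) (at w0)"
      by (simp add: F_def mult_ac)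
  qed
  show ?thesis
  proof (rule characteristic_transformI[OF _ tower, where G = "Gbar \<beta> (\<lambda>_. 1)"])
    show "g_fun \<alpha> \<alpha>' (LogPt w) = F 0 w" if "w \<in> logstrip \<alpha>" for w
    proof -
      have "admissible_angle \<alpha> \<alpha>' (LogPt w) (\<phi> w)"
        using ang[OF that] by (simp add: admissible_angle_def \<beta>_def rarg_def abs_less_iff)
      then show ?thesis
        using g_fun_eq_gint[OF \<alpha>, of "p w" w] p_dom[OF that] by (auto simp: F_def \<beta>_def)
    qed
    show "norm (F n w) \<le> 2 / k * (((2 * \<beta>) powr \<beta>) * (1 / k powr \<beta>)) ^ n * Gbar \<beta> (\<lambda>_. 1) n"
      if "w \<in> logstrip \<alpha>" for n w
    proof -
      have "norm (F n w) \<le> Gamma (\<beta> * real n + 1) / k powr (\<beta> * real n + 1)"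
        using norm_gint_le[OF \<beta>(1) p_dom[OF that] _ k k_le[OF that]]
        by (simp add: F_def norm_mult norm_power p_def)
      also have "k powr (\<beta> * real n + 1) = (k powr \<beta>) ^ n * k"
        using k by (simp add: powr_add powr_power_mult)
      also have "Gamma (\<beta> * real n + 1) / ((k powr \<beta>) ^ n * k) \<le>
          2 * ((2 * \<beta>) powr \<beta>) ^ n * Gbar \<beta> (\<lambda>_. 1) n / ((k powr \<beta>) ^ n * k)"
        using Gamma_le_Gbar[OF \<beta>(1), of n] k by (intro divide_right_mono) auto
      finally show ?thesis by (simp add: power_mult_distrib power_divide field_simps)
    qed
    \<comment> \<open>On the real line of the chart the direction is \<open>p = 0\<close>.\<close>
    show "((\<lambda>x::real. F n (of_real x)) \<longlongrightarrow> (-1) ^ n * of_real (Gamma (\<beta> * real n + 1))) at_bot" for n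
      unfolding F_def p_def \<phi>_def using gint_tendsto[OF \<beta>(1), of n]
      by (intro tendsto_mult tendsto_const) simp
    show "1 * ((\<beta> / exp 1) powr \<beta>) ^ n * Gbar \<beta> (\<lambda>_. 1) n \<le> norm ((-1) ^ n * complex_of_real (Gamma (\<beta> * real n + 1)))" for n
      using Gamma_ge_Gbar[OF \<beta>(1), of n] by (simp add: norm_mult norm_power)
    show "pos_seq (Gbar \<beta> (\<lambda>_. 1))" by (simp add: pos_seq_def Gbar_def)
    show "seq_equiv M (\<lambda>n. Gbar \<beta> (\<lambda>_. 1) n * L n)" using equiv by (simp add: \<beta>_def)
  qed (use \<alpha> \<beta> k M L in auto)
qed

section \<open>Integrals along vertical lines\<close>

definition vline :: "(complex \<Rightarrow> complex) \<Rightarrow> real \<Rightarrow> complex" where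
  "vline F r = (\<integral>y. F (Complex r y) \<partial>lborel)"

lemma Complex_conv_ii: "Complex r y = of_real r + \<i> * of_real y"
  by (simp add: complex_eq_iff)

lemma frac_le_cross:
  fixes a b c d :: real
  assumes "0 < b" "0 < d" "a * d \<le> c * b"
  shows "a / b \<le> c / d"
  using assms by (simp add: pos_divide_le_eq pos_le_divide_eq)

text \<open>The arctangent integral, rescaled by \<open>r\<close>.\<close>

lemma has_bochner_integral_inverse_square:
  fixes r :: real
  assumes r: "r > 0"
  shows "has_bochner_integral lborel (\<lambda>y. 1 / (r\<^sup>2 + y\<^sup>2)) (pi / r)"
proof -
  have e: "einterval (- \<infinity>) \<infinity> = UNIV" by (auto simp: einterval_def)
  have int: "integrable lborel (\<lambda>x::real. inverse (1 + x\<^sup>2))"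
    using integrable_inverse_1_plus_square by (simp add: e set_integrable_def)
  have val: "(\<integral>x. inverse (1 + x\<^sup>2) \<partial>lborel) = pi"
    using LBINT_inverse_1_plus_square
    by (simp add: interval_lebesgue_integral_def e set_lebesgue_integral_def)
  have *: "has_bochner_integral lborel (\<lambda>x. 1 / (r\<^sup>2 + (0 + r * x)\<^sup>2)) (inverse (r\<^sup>2) * pi)"
  proof -
    have "has_bochner_integral lborel (\<lambda>x. inverse (r\<^sup>2) * inverse (1 + x\<^sup>2)) (inverse (r\<^sup>2) * pi)"
      using int val by (intro has_bochner_integral_mult_right) (simp add: has_bochner_integral_iff)
    moreover have "inverse (r\<^sup>2) * inverse (1 + x\<^sup>2) = 1 / (r\<^sup>2 + (0 + r * x)\<^sup>2)" for x :: real
      by (simp add: power_mult_distrib inverse_eq_divide ring_distribs)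
    ultimately show ?thesis by simp
  qed
  have "has_bochner_integral lborel (\<lambda>x. 1 / (r\<^sup>2 + (0 + r * x)\<^sup>2)) ((pi / r) /\<^sub>R \<bar>r\<bar>)"
    using * r by (simp add: power2_eq_square field_simps)
  then show ?thesis
    using r by (subst lborel_has_bochner_integral_real_affine_iff[of r _ _ 0]) auto
qed

lemma integrable_one_plus_square: "integrable lborel (\<lambda>y::real. C / (1 + y\<^sup>2))"
proof -
  have "integrable lborel (\<lambda>y::real. C * (1 / (1 + y\<^sup>2)))"
    using has_bochner_integral_inverse_square[of 1]
    by (intro integrable_mult_right) (auto simp: has_bochner_integral_iff)
  then show ?thesis by simp
qed

lemma vline_measurable:
  assumes holo: "F holomorphic_on {u. Re u > p}" and c: "Re c > p"
  shows "(\<lambda>y::real. F (c + \<i> * of_real y)) \<in> borel_measurable lborel"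
proof -
  have "continuous_on UNIV (\<lambda>y::real. F (c + \<i> * of_real y))"
    by (intro continuous_on_compose2[OF holomorphic_on_imp_continuous_on[OF holo]] continuous_intros)
      (use c in auto)
  then show ?thesis using borel_measurable_continuous_onI by simp
qed

lemma integrable_vline:
  assumes holo: "F holomorphic_on {u. Re u > p}"
    and bound: "\<And>r0 r1. p < r0 \<Longrightarrow> \<exists>C. \<forall>u. r0 \<le> Re u \<and> Re u \<le> r1 \<longrightarrow> norm (F u) \<le> C / (1 + (Im u)\<^sup>2)"
    and a: "a > p"
  shows "integrable lborel (\<lambda>y. F (Complex a y))"
proof -
  obtain C where C: "\<And>u. a \<le> Re u \<Longrightarrow> Re u \<le> a \<Longrightarrow> norm (F u) \<le> C / (1 + (Im u)\<^sup>2)"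
    using bound[OF a, of a] by blast
  show ?thesis
  proof (rule Bochner_Integration.integrable_bound[OF integrable_one_plus_square[of C]])
    show "(\<lambda>y. F (Complex a y)) \<in> borel_measurable lborel"
      using vline_measurable[OF holo, of "of_real a"] a by (simp add: Complex_conv_ii)
    have "norm (F (Complex a y)) \<le> norm (C / (1 + y\<^sup>2))" for y
      unfolding real_norm_def by (intro order_trans[OF _ abs_ge_self]) (use C[of "Complex a y"] in simp)
    then show "AE y in lborel. norm (F (Complex a y)) \<le> norm (C / (1 + y\<^sup>2))" by simp
  qed
qed

text \<open>The abscissa is extended to a complex parameter \<open>c\<close>. The integral along
  \<open>c\<close> plus the imaginary axis is holomorphic in \<open>c\<close> and unchanged by
  imaginary shifts, hence constant on the half-plane.\<close>

lemma vline_eq: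
  assumes holo: "F holomorphic_on {u. Re u > p}"
    and bound: "\<And>r0 r1. p < r0 \<Longrightarrow> \<exists>C. \<forall>u. r0 \<le> Re u \<and> Re u \<le> r1 \<longrightarrow> norm (F u) \<le> C / (1 + (Im u)\<^sup>2)"
    and ab: "a > p" "b > p"
  shows "vline F a = vline F b"
proof -
  let ?U = "{u. Re u > p}"
  define f where "f c y = F (c + \<i> * of_real y)" for c and y :: real
  define J where "J c = (\<integral>y. f c y \<partial>lborel)" for c
  have U: "open ?U" by (rule open_halfspace_Re_gt)
  have deriv: "(J has_field_derivative (\<integral>y. deriv (\<lambda>c. f c y) c0 \<partial>lborel)) (at c0)" if c0: "c0 \<in> ?U" for c0
    unfolding J_def
  proof (rule has_field_derivative_integral[OF U _ _ _ c0])
    fix c assume "c \<in> ?U"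
    then show "f c \<in> borel_measurable lborel"
      unfolding f_def by (intro vline_measurable[OF holo]) simp
  next
    show "(\<lambda>c. f c y) holomorphic_on ?U" for y
      unfolding f_def
      by (rule holomorphic_on_compose_gen[OF _ holo, unfolded o_def]) (auto intro!: holomorphic_intros)
  next
    fix c0 assume c0: "c0 \<in> ?U"
    define r0 where "r0 = (p + Re c0) / 2"
    have r0: "p < r0" "r0 < Re c0" using c0 by (auto simp: r0_def)
    obtain C where C: "\<And>u. r0 \<le> Re u \<Longrightarrow> Re u \<le> Re c0 + 1 \<Longrightarrow> norm (F u) \<le> C / (1 + (Im u)\<^sup>2)"
      using bound[OF r0(1), of "Re c0 + 1"] by blast
    define e where "e = min 1 (Re c0 - r0)"
    \<comment> \<open>The majorant must be the same for all \<open>c\<close> near \<open>c0\<close>.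
      A shift \<open>t\<close> of the imaginary part by at most 1 costs a factor 3: 1 + (s + t)^2 <=
      3 + 2 s^2.\<close>
    have "norm (f c y) \<le> 3 * \<bar>C\<bar> / (1 + (Im c0 + 1 * y)\<^sup>2)" if "c \<in> ball c0 e" for c y
    proof -
      have d: "\<bar>Re c - Re c0\<bar> < e" "\<bar>Im c - Im c0\<bar> < 1"
        using that abs_Re_le_cmod[of "c - c0"] abs_Im_le_cmod[of "c - c0"]
        by (auto simp: dist_norm norm_minus_commute e_def)
      have "norm (f c y) \<le> C / (1 + (Im c + y)\<^sup>2)"
      proof -
        have "r0 \<le> Re c" "Re c \<le> Re c0 + 1" using d(1) by (auto simp: e_def)
        then show ?thesis using C[of "c + \<i> * of_real y"] by (simp add: f_def)
      qed
      also have "\<dots> \<le> 3 * \<bar>C\<bar> / (1 + (Im c0 + 1 * y)\<^sup>2)"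
      proof -
        define s t where "s = Im c + y" and "t = Im c0 - Im c"
        have "t\<^sup>2 \<le> 1" using d(2) by (simp add: t_def abs_square_le_1 abs_minus_commute)
        moreover have "(s + t)\<^sup>2 \<le> 2 * s\<^sup>2 + 2 * t\<^sup>2"
          using zero_le_power2[of "s - t"] by (simp add: power2_eq_square algebra_simps)
        moreover have "1 + x \<le> 3 * (1 + a)" if "b \<le> 1" "x \<le> 2 * a + 2 * b" "0 \<le> a" for a b x :: real
          using that by simp
        ultimately have "1 + (s + t)\<^sup>2 \<le> 3 * (1 + s\<^sup>2)"
          by (metis zero_le_power2)
        then have "C * (1 + (s + t)\<^sup>2) \<le> \<bar>C\<bar> * (3 * (1 + s\<^sup>2))"
          by (intro mult_mono) auto
        moreover have "1 + s\<^sup>2 > 0" "1 + (s + t)\<^sup>2 > 0" by (simp_all add: add_pos_nonneg)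
        ultimately have "C / (1 + s\<^sup>2) \<le> 3 * \<bar>C\<bar> / (1 + (s + t)\<^sup>2)"
          by (intro frac_le_cross) (simp_all add: mult_ac)
        then show ?thesis by (simp add: s_def t_def add_ac)
      qed
      finally show ?thesis .
    qed
    moreover have "integrable lborel (\<lambda>y. 3 * \<bar>C\<bar> / (1 + (Im c0 + 1 * y)\<^sup>2))"
      by (rule lborel_integrable_real_affine[OF integrable_one_plus_square]) simp
    ultimately show "\<exists>e>0. \<exists>B. integrable lborel B \<and> (\<forall>c\<in>ball c0 e \<inter> ?U. \<forall>y. norm (f c y) \<le> B y)"
      using r0 by (intro exI[of _ e] conjI exI[of _ "\<lambda>y. 3 * \<bar>C\<bar> / (1 + (Im c0 + 1 * y)\<^sup>2)"])
        (auto simp: e_def)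
  qed
  \<comment> \<open>An imaginary shift of \<open>c\<close> is a translation of the real variable of
    integration.\<close>
  have inv: "J (c + of_real s * \<i>) = J c" for c s
  proof -
    have "J c = \<bar>1\<bar> *\<^sub>R (\<integral>y. f c (s + 1 * y) \<partial>lborel)"
      unfolding J_def by (rule lborel_integral_real_affine) simp
    also have "\<dots> = J (c + of_real s * \<i>)"
      by (simp add: J_def f_def algebra_simps)
    finally show ?thesis by simp
  qed
  have "(J has_field_derivative 0) (at c within ?U)" if "c \<in> ?U" for c
    using has_field_derivative_invariant_zero[OF deriv[OF that] _ inv] deriv[OF that]
    by (simp add: has_field_derivative_at_within)
  from has_field_derivative_zero_constant[OF convex_halfspace_Re_gt this]
  obtain k where "\<And>c. c \<in> ?U \<Longrightarrow> J c = k" by blast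
  moreover have "vline F r = J (of_real r)" for r
    by (simp add: vline_def J_def f_def Complex_conv_ii)
  ultimately show ?thesis using ab by simp
qed

section \<open>Kernel estimates and Hankel's formula\<close>

lemma inverse_norm_square_le:
  assumes "0 < r" "r \<le> Re u"
  shows "1 / (norm u)\<^sup>2 \<le> (1 + 1 / r\<^sup>2) / (1 + (Im u)\<^sup>2)"
proof -
  have "r\<^sup>2 \<le> (Re u)\<^sup>2" using assms by (intro power_mono) auto
  then have n: "r\<^sup>2 + (Im u)\<^sup>2 \<le> (norm u)\<^sup>2" by (simp add: cmod_power2)
  have "1 + (Im u)\<^sup>2 \<le> (1 + 1 / r\<^sup>2) * (r\<^sup>2 + (Im u)\<^sup>2)"
    using assms by (simp add: field_simps)
  also have "\<dots> \<le> (1 + 1 / r\<^sup>2) * (norm u)\<^sup>2"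
    by (rule mult_left_mono[OF n]) (simp add: add_nonneg_nonneg)
  finally have "1 + (Im u)\<^sup>2 \<le> (1 + 1 / r\<^sup>2) * (norm u)\<^sup>2" .
  moreover have "norm u > 0" using assms by auto
  moreover have "1 + (Im u)\<^sup>2 > 0" by (simp add: add_pos_nonneg)
  ultimately show ?thesis
    by (intro frac_le_cross) auto
qed

lemma norm_powr_minus_le:
  assumes "0 < r" "r \<le> Re u" "2 \<le> s"
  shows "norm (u powr (- of_real s)) \<le> r powr (2 - s) * (1 / (norm u)\<^sup>2)"
proof -
  have u: "r \<le> norm u" using assms(2) complex_Re_le_cmod[of u] by linarith
  have "norm (u powr (- of_real s)) = norm u powr (- s)"
    by (subst norm_powr_real_powr') auto
  also have "\<dots> = norm u powr (2 - s) * norm u powr (- 2)"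
    using u assms by (simp flip: powr_add)
  also have "\<dots> \<le> r powr (2 - s) * norm u powr (- 2)"
    using u assms by (intro mult_right_mono powr_mono2') auto
  also have "norm u powr (- 2) = 1 / (norm u)\<^sup>2"
    using u assms by (simp add: powr_minus powr_numeral divide_inverse)
  finally show ?thesis .
qed

text \<open>Subtracting \<open>1 / u\<close> from the power yields \<open>h\<close> with
  \<open>h 1 = 0\<close>, so the singularity of \<open>Q\<close> at 1 is removable and
  \<open>Q\<close> decays quadratically. Its line integral does not depend on the abscissa and tends
  to 0 as the line moves right, hence is 0. What remains is the integral of 1 / (u (1 - u)),
  computed on the line of abscissa 1/2.\<close>

lemma cauchy_kernel_integral:
  assumes s: "s \<ge> 1"
  shows "vline (\<lambda>u. u powr (- of_real s) / (1 - u)) (1 / 2) = 2 * pi"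
proof -
  let ?U = "{u::complex. Re u > 0}"
  define h where "h u = u powr (- of_real s) - 1 / u" for u :: complex
  define Q where "Q u = (if u = 1 then deriv h 1 else (h u - h 1) / (u - 1))" for u
  have h1: "h 1 = 0" by (simp add: h_def)
  have holo_h: "h holomorphic_on ?U"
    unfolding h_def by (intro holomorphic_intros) (auto simp: complex_nonpos_Reals_iff)
  have holo: "Q holomorphic_on ?U"
    unfolding Q_def by (rule pole_lemma_open[OF holo_h open_halfspace_Re_gt])
  have h_le: "norm (h u) \<le> 2 / norm u" if "norm u \<ge> 1" for u
  proof -
    have "norm (u powr (- of_real s)) = norm u powr (- s)"
      by (subst norm_powr_real_powr') auto
    also have "\<dots> \<le> norm u powr (- 1)" using that s by (intro powr_mono) auto
    also have "\<dots> = 1 / norm u" using that by (simp add: powr_minus_divide)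
    finally have "norm (u powr (- of_real s)) \<le> 1 / norm u" .
    then show ?thesis
      using norm_triangle_ineq4[of "u powr (- of_real s)" "1 / u"] by (simp add: h_def norm_divide)
  qed
  have bound: "\<exists>C. \<forall>u. r0 \<le> Re u \<and> Re u \<le> r1 \<longrightarrow> norm (Q u) \<le> C / (1 + (Im u)\<^sup>2)"
    if r0: "0 < r0" for r0 r1
  proof -
    let ?K = "cbox (Complex r0 (-1)) (Complex r1 1)"
    have "continuous_on ?K Q"
      by (rule continuous_on_subset[OF holomorphic_on_imp_continuous_on[OF holo]])
        (use r0 in \<open>auto simp: in_cbox_complex_iff\<close>)
    then have "bounded (Q ` ?K)"
      using compact_cbox compact_continuous_image compact_imp_bounded by blast
    then obtain K where K: "\<And>u. u \<in> ?K \<Longrightarrow> norm (Q u) \<le> K"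
      by (auto simp: bounded_iff)
    have "norm (Q u) \<le> (2 * \<bar>K\<bar> + 4) / (1 + (Im u)\<^sup>2)" if u: "r0 \<le> Re u" "Re u \<le> r1" for u
    proof (cases "\<bar>Im u\<bar> \<le> 1")
      case True
      then have "norm (Q u) \<le> K" using u by (intro K) (auto simp: in_cbox_complex_iff)
      also have "K \<le> (2 * \<bar>K\<bar> + 4) / (1 + (Im u)\<^sup>2)"
      proof -
        have "(Im u)\<^sup>2 \<le> 1" using True by (simp add: abs_square_le_1)
        then have "K * (1 + (Im u)\<^sup>2) \<le> \<bar>K\<bar> * 2" by (intro mult_mono) auto
        then show ?thesis by (simp add: pos_le_divide_eq add_pos_nonneg)
      qed
      finally show ?thesis .
    next
      case False
      then have im: "\<bar>Im u\<bar> > 1" by simp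
      then have u1: "\<bar>Im u\<bar> \<le> norm u" "\<bar>Im u\<bar> \<le> norm (u - 1)" "u \<noteq> 1"
        using abs_Im_le_cmod[of u] abs_Im_le_cmod[of "u - 1"] by auto
      have "norm (Q u) = norm (h u) / norm (u - 1)"
        using u1 by (simp add: Q_def h1 norm_divide)
      also have "\<dots> \<le> (2 / norm u) / norm (u - 1)"
        using h_le[of u] u1 im by (intro divide_right_mono) auto
      also have "\<dots> \<le> (2 / \<bar>Im u\<bar>) / \<bar>Im u\<bar>"
        using u1 im by (intro frac_le) auto
      also have "\<dots> = 2 / (Im u)\<^sup>2" by (simp add: power2_eq_square)
      also have "\<dots> \<le> (2 * \<bar>K\<bar> + 4) / (1 + (Im u)\<^sup>2)"
      proof -
        have sq: "1 < (Im u)\<^sup>2" using im by (metis one_less_power power2_abs zero_less_numeral)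
        have "2 * (1 + (Im u)\<^sup>2) \<le> 4 * (Im u)\<^sup>2" using sq by simp
        also have "\<dots> \<le> (2 * \<bar>K\<bar> + 4) * (Im u)\<^sup>2" by (intro mult_right_mono) auto
        finally show ?thesis using sq by (intro frac_le_cross) auto
      qed
      finally show ?thesis .
    qed
    then show ?thesis by blast
  qed
  have const: "vline Q r = vline Q (1 / 2)" if "r > 0" for r
    by (rule vline_eq[OF holo bound]) (use that in auto)
  \<comment> \<open>For \<open>r \<ge> 2\<close> one has |h u| <= 2/|u| and |u - 1| >= |u|/2, so the
    integrand is at most 4/|u|^2.\<close>
  have "norm (vline Q (1 / 2)) \<le> 4 * pi / r" if r: "r \<ge> 2" for r
  proof -
    have I: "has_bochner_integral lborel (\<lambda>y. 4 * (1 / (r\<^sup>2 + y\<^sup>2))) (4 * (pi / r))"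
      using r by (intro has_bochner_integral_mult_right has_bochner_integral_inverse_square) auto
    have "norm (vline Q r) \<le> (\<integral>y. 4 * (1 / (r\<^sup>2 + y\<^sup>2)) \<partial>lborel)"
      unfolding vline_def
    proof (rule order_trans[OF integral_norm_bound integral_mono'])
      show "integrable lborel (\<lambda>y. 4 * (1 / (r\<^sup>2 + y\<^sup>2)))" using I by (simp add: has_bochner_integral_iff)
      fix y :: real
      let ?u = "Complex r y"
      have n: "norm ?u \<ge> 2" using complex_Re_le_cmod[of ?u] r by simp
      have "norm ?u / 2 \<le> norm (?u - 1)"
        using norm_triangle_ineq2[of ?u 1] n by simp
      then have "norm (h ?u) / norm (?u - 1) \<le> (2 / norm ?u) / (norm ?u / 2)"
        using n h_le[of ?u] by (intro frac_le) auto
      also have "\<dots> = 4 / (norm ?u)\<^sup>2" using n by (simp add: power2_eq_square)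
      also have "\<dots> = 4 * (1 / (r\<^sup>2 + y\<^sup>2))" by (simp add: cmod_power2)
      finally show "norm (Q ?u) \<le> 4 * (1 / (r\<^sup>2 + y\<^sup>2))"
        using r by (auto simp: Q_def h1 norm_divide complex_eq_iff)
    qed auto
    also have "\<dots> = 4 * (pi / r)" using I by (simp add: has_bochner_integral_iff)
    finally show ?thesis using const[of r] r by simp
  qed
  then have "norm (vline Q (1 / 2)) \<le> 0"
    by (intro tendsto_lowerbound[of "\<lambda>r. 4 * pi / r" 0 at_top])
      (auto intro!: tendsto_divide_0[OF tendsto_const] filterlim_at_top_imp_at_infinity filterlim_ident
        eventually_at_top_linorderI[of 2])
  then have Q0: "vline Q (1 / 2) = 0" by simp
  have I: "has_bochner_integral lborel (\<lambda>y::real. complex_of_real (1 / ((1 / 2)\<^sup>2 + y\<^sup>2))) (complex_of_real (pi / (1 / 2)))"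
    by (intro has_bochner_integral_of_real has_bochner_integral_inverse_square) simp
  have eq: "u powr (- of_real s) / (1 - u) = of_real (1 / ((1 / 2)\<^sup>2 + y\<^sup>2)) - Q u"
    if "u = Complex (1 / 2) y" for u y
  proof -
    have nz: "u \<noteq> 1" "u \<noteq> 0" using that by (auto simp: complex_eq_iff)
    \<comment> \<open>On this line \<open>1 - u\<close> is the complex conjugate of
      \<open>u\<close>.\<close>
    have "u * (1 - u) = of_real ((1 / 2)\<^sup>2 + y\<^sup>2)"
      by (simp add: that complex_eq_iff power2_eq_square field_simps)
    then have 1: "of_real (1 / ((1 / 2)\<^sup>2 + y\<^sup>2)) = 1 / (u * (1 - u))" by simp
    have 2: "Q u = (1 / u - u powr (- of_real s)) / (1 - u)"
      using nz by (simp add: Q_def h1) (simp add: h_def field_simps)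
    show ?thesis unfolding 1 2 by (simp add: diff_divide_distrib)
  qed
  have intQ: "integrable lborel (\<lambda>y. Q (Complex (1 / 2) y))"
    by (rule integrable_vline[OF holo bound]) auto
  have "vline (\<lambda>u. u powr (- of_real s) / (1 - u)) (1 / 2) =
      (\<integral>y. of_real (1 / ((1 / 2)\<^sup>2 + y\<^sup>2)) - Q (Complex (1 / 2) y) \<partial>lborel)"
    unfolding vline_def by (intro Bochner_Integration.integral_cong refl eq)
  also have "\<dots> = complex_of_real (pi / (1 / 2)) - vline Q (1 / 2)"
    unfolding vline_def using I intQ
    by (subst Bochner_Integration.integral_diff) (auto simp only: has_bochner_integral_iff)
  finally show ?thesis by (simp add: Q0)
qed

lemma exp_integral:
  assumes c: "Re c > 0"
  shows "has_bochner_integral lborel (\<lambda>t::real. of_real (indicator {0<..} t) * exp (- of_real t * c)) (1 / c)"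
proof -
  let ?f = "\<lambda>t::real. exp (- of_real t * c)" and ?F = "\<lambda>t::real. - (exp (- of_real t * c) / c)"
  have c0: "c \<noteq> 0" using c by auto
  have e: "einterval 0 \<infinity> = {0<..}" by (auto simp: einterval_def)
  have int: "set_integrable lborel {0<..} ?f"
    unfolding set_integrable_def
  proof (rule Bochner_Integration.integrable_bound)
    show "integrable lborel (\<lambda>t. indicator {0<..} t * (t powr 0 * exp (- Re c * t)))"
      using has_bochner_integral_Gamma[of 0 "Re c"] c by (simp add: has_bochner_integral_iff)
  qed (auto simp: indicator_def mult.commute)
  have "(LBINT t=0..\<infinity>. ?f t) = 0 - (- (1 / c))"
  proof (rule interval_integral_FTC_integrable)
    have "((\<lambda>z. - (exp (- z * c) / c)) has_field_derivative exp (- z * c)) (at z)" for z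
      using c0 by (auto intro!: derivative_eq_intros)
    then show "(?F has_vector_derivative ?f t) (at t)" for t
      by (rule has_vector_derivative_real_field)
    show "set_integrable lborel (einterval 0 \<infinity>) ?f" using int by (simp only: e)
    have "isCont ?F 0" using c0 by (intro continuous_intros) auto
    then have "(?F \<longlongrightarrow> - (1 / c)) (at_right 0)"
      by (auto simp: isCont_def dest: filterlim_at_split[THEN iffD1])
    then show "((?F \<circ> real_of_ereal) \<longlongrightarrow> - (1 / c)) (at_right 0)"
      by (simp add: zero_ereal_def ereal_tendsto_simps)
    have "((\<lambda>t. exp (- (t * Re c))) \<longlongrightarrow> 0) at_top"
      using c by (auto intro!: exp_at_bot[THEN filterlim_compose] filterlim_tendsto_pos_mult_at_top
          filterlim_ident simp: filterlim_uminus_at_bot mult.commute[of _ "Re c"])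
    then have "(?f \<longlongrightarrow> 0) at_top"
      by (subst tendsto_norm_zero_iff[symmetric]) simp
    then have "(?F \<longlongrightarrow> - (0 / c)) at_top"
      by (intro tendsto_intros c0)
    then show "((?F \<circ> real_of_ereal) \<longlongrightarrow> 0) (at_left \<infinity>)"
      by (simp add: ereal_tendsto_simps)
  qed auto
  then have "(LINT t:{0<..}|lborel. ?f t) = 1 / c"
    by (simp add: interval_lebesgue_integral_def e)
  then show ?thesis
    using int by (simp add: has_bochner_integral_iff set_integrable_def set_lebesgue_integral_def scaleR_conv_of_real)
qed

text \<open>The exponential is bounded on a strip of bounded abscissa, and the power decays at least
  quadratically because \<open>s \<ge> 2\<close>.\<close>

lemma hankel_integrand_bound:
  assumes s: "s \<ge> 2" and r0: "0 < r0"
  shows "\<exists>C. \<forall>u. r0 \<le> Re u \<and> Re u \<le> r1 \<longrightarrow>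
    norm (exp (of_real t * u) * u powr (- of_real s)) \<le> C / (1 + (Im u)\<^sup>2)"
proof (intro exI allI impI)
  fix u assume u: "r0 \<le> Re u \<and> Re u \<le> r1"
  let ?C = "exp (\<bar>t\<bar> * \<bar>r1\<bar>) * (r0 powr (2 - s) * (1 + 1 / r0\<^sup>2))"
  have "t * Re u \<le> \<bar>t\<bar> * \<bar>r1\<bar>"
    using u r0 by (intro order_trans[OF abs_ge_self[of "t * Re u"]])
      (auto simp: abs_mult intro!: mult_left_mono)
  then have "norm (exp (of_real t * u)) \<le> exp (\<bar>t\<bar> * \<bar>r1\<bar>)" by simp
  moreover have "norm (u powr (- of_real s)) \<le> r0 powr (2 - s) * ((1 + 1 / r0\<^sup>2) / (1 + (Im u)\<^sup>2))"
    using norm_powr_minus_le[of r0 u s] inverse_norm_square_le[of r0 u] u r0 s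
    by (meson order_trans mult_left_mono powr_ge_zero)
  ultimately have "norm (exp (of_real t * u) * u powr (- of_real s)) \<le>
      exp (\<bar>t\<bar> * \<bar>r1\<bar>) * (r0 powr (2 - s) * ((1 + 1 / r0\<^sup>2) / (1 + (Im u)\<^sup>2)))"
    unfolding norm_mult by (intro mult_mono) auto
  then show "norm (exp (of_real t * u) * u powr (- of_real s)) \<le> ?C / (1 + (Im u)\<^sup>2)" by simp
qed

lemma hankel_integrand_holomorphic:
  "(\<lambda>u. exp (of_real t * u) * u powr (- of_real s)) holomorphic_on {u. Re u > 0}"
  by (intro holomorphic_intros) (auto simp: complex_nonpos_Reals_iff)

text \<open>Substituting \<open>t * u\<close> for \<open>u\<close>: the power scales by
  \<open>t powr (- s)\<close> and the line element by \<open>t\<close>.\<close>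

lemma hankel_scale:
  assumes t: "t > 0"
  shows "vline (\<lambda>u. exp (of_real t * u) * u powr (- of_real s)) r =
    of_real (t powr (s - 1)) * vline (\<lambda>u. exp u * u powr (- of_real s)) (t * r)"
proof -
  have "vline (\<lambda>u. exp u * u powr (- of_real s)) (t * r) =
      \<bar>t\<bar> *\<^sub>R (\<integral>y. exp (Complex (t * r) (0 + t * y)) * Complex (t * r) (0 + t * y) powr (- of_real s) \<partial>lborel)"
    unfolding vline_def by (rule lborel_integral_real_affine) (use t in simp)
  also have "(\<lambda>y. exp (Complex (t * r) (0 + t * y)) * Complex (t * r) (0 + t * y) powr (- of_real s)) =
      (\<lambda>y. of_real (t powr (- s)) * (exp (of_real t * Complex r y) * Complex r y powr (- of_real s)))"
  proof
    fix y
    have eq: "Complex (t * r) (0 + t * y) = of_real t * Complex r y"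
      by (simp add: complex_eq_iff)
    show "exp (Complex (t * r) (0 + t * y)) * Complex (t * r) (0 + t * y) powr (- of_real s) =
        of_real (t powr (- s)) * (exp (of_real t * Complex r y) * Complex r y powr (- of_real s))"
    proof (cases "Complex r y = 0")
      case False
      then have "(of_real t * Complex r y) powr (- of_real s) =
          of_real (t powr (- s)) * Complex r y powr (- of_real s)"
        using t Ln_times_of_real[OF t False] Ln_of_real[OF t]
        by (simp add: powr_def exp_of_real[symmetric] distrib_left flip: exp_add)
      then show ?thesis unfolding eq by simp
    next
      case True
      then show ?thesis unfolding eq by simp
    qed
  qed
  also have "\<bar>t\<bar> *\<^sub>R (\<integral>y. of_real (t powr (- s)) * (exp (of_real t * Complex r y) * Complex r y powr (- of_real s)) \<partial>lborel)
      = of_real (t powr (1 - s)) * vline (\<lambda>u. exp (of_real t * u) * u powr (- of_real s)) r"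
    unfolding vline_def using t
    by (simp add: scaleR_conv_of_real powr_diff powr_minus divide_inverse)
  finally have "of_real (t powr (s - 1)) * vline (\<lambda>u. exp u * u powr (- of_real s)) (t * r) =
      of_real (t powr (s - 1) * t powr (1 - s)) * vline (\<lambda>u. exp (of_real t * u) * u powr (- of_real s)) r"
    by simp
  also have "t powr (s - 1) * t powr (1 - s) = 1"
    using t by (simp flip: powr_add)
  finally show ?thesis by simp
qed

text \<open>Hankel's formula along a vertical line: by Fubini, the Laplace transform at \<open>1\<close> of
  \<open>t \<mapsto> \<integral> exp (t u) u powr (-s)\<close> is the Cauchy integral of \<open>u powr (-s)\<close>, while the scaling
  \<open>u \<mapsto> u / t\<close> identifies it with a multiple of \<open>Gamma s\<close>.\<close>

lemma vline_hankel:
  assumes s: "s \<ge> 2" and r: "r > 0"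
  shows "vline (\<lambda>u. exp u * u powr (- of_real s)) r = 2 * pi / Gamma s"
proof -
  define K where "K = vline (\<lambda>u. exp u * u powr (- of_real s)) r"
  have K: "vline (\<lambda>u. exp u * u powr (- of_real s)) r' = K" if "r' > 0" for r'
    unfolding K_def
    using vline_eq[OF hankel_integrand_holomorphic[of 1 s] hankel_integrand_bound[OF s, of _ _ 1], of r' r] r that
    by simp
  define G where "G u = u powr (- of_real s)" for u :: complex
  \<comment> \<open>The integrand of the double integral. On abscissa 1/2 the weight
    \<open>exp (- t)\<close> wins against \<open>exp (t * u)\<close>, leaving decay
    \<open>exp (- t / 2)\<close>, so Fubini applies.\<close>
  define f where "f t y = of_real (indicator {0<..} t) * exp (- of_real t) *
      (exp (of_real t * Complex (1/2) y) * G (Complex (1/2) y))" for t y :: real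
  have G_int: "integrable lborel (\<lambda>y. G (Complex (1/2) y))"
    using integrable_vline[OF hankel_integrand_holomorphic[of 0 s] hankel_integrand_bound[OF s, of _ _ 0], of "1/2"]
    by (simp add: G_def)
  have [measurable]: "(\<lambda>y. G (Complex (1/2) y)) \<in> borel_measurable borel"
    using borel_measurable_integrable[OF G_int] by simp
  have norm_f: "norm (f t y) = indicator {0<..} t * (t powr 0 * exp (- (1/2) * t)) * norm (G (Complex (1/2) y))" for t y
    by (auto simp: f_def norm_mult indicator_def simp flip: exp_add)
  have k: "integrable lborel (\<lambda>t::real. indicator {0<..} t * (t powr 0 * exp (- (1/2) * t)))"
    using has_bochner_integral_Gamma[of 0 "1/2"] by (simp add: has_bochner_integral_iff)
  have f_int: "integrable (lborel \<Otimes>\<^sub>M lborel) (case_prod f)"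
  proof (rule lborel_pair.Fubini_integrable)
    have "case_prod f = (\<lambda>(t, y). of_real (indicator {0<..} t) * exp (- of_real t) *
      (exp (of_real t * (1/2 + \<i> * of_real y)) * G (Complex (1/2) y)))"
      by (auto simp: f_def Complex_conv_ii)
    then show "case_prod f \<in> borel_measurable (lborel \<Otimes>\<^sub>M lborel)" by simp
    show "integrable lborel (\<lambda>t. \<integral>y. norm (case_prod f (t, y)) \<partial>lborel)"
      using k by (simp add: norm_f)
    show "AE t in lborel. integrable lborel (\<lambda>y. case_prod f (t, y))"
    proof (rule AE_I2)
      fix t :: real
      show "integrable lborel (\<lambda>y. case_prod f (t, y))"
      proof (rule Bochner_Integration.integrable_bound)
        show "integrable lborel (\<lambda>y. indicator {0<..} t * (t powr 0 * exp (- (1/2) * t)) * norm (G (Complex (1/2) y)))"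
          using G_int by (intro integrable_mult_right integrable_norm)
        have "(\<lambda>y. case_prod f (t, y)) = (\<lambda>y. of_real (indicator {0<..} t) * exp (- of_real t) *
          (exp (of_real t * (1/2 + \<i> * of_real y)) * G (Complex (1/2) y)))"
          by (auto simp: f_def Complex_conv_ii)
        then show "(\<lambda>y. case_prod f (t, y)) \<in> borel_measurable lborel" by simp
      qed (simp add: norm_f)
    qed
  qed
  \<comment> \<open>Integrating over \<open>t\<close> first gives the Cauchy kernel
    \<open>1 / (1 - u)\<close>.\<close>
  have "(\<integral>t. f t y \<partial>lborel) = G (Complex (1/2) y) / (1 - Complex (1/2) y)" for y
  proof -
    have "has_bochner_integral lborel (\<lambda>t. of_real (indicator {0<..} t) *
        exp (- of_real t * (1 - Complex (1/2) y)) * G (Complex (1/2) y)) (1 / (1 - Complex (1/2) y) * G (Complex (1/2) y))"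
      by (intro has_bochner_integral_mult_left exp_integral) simp
    moreover have "f t y = of_real (indicator {0<..} t) *
        exp (- of_real t * (1 - Complex (1/2) y)) * G (Complex (1/2) y)" for t
      by (simp add: f_def algebra_simps flip: exp_add)
    ultimately show ?thesis by (simp add: has_bochner_integral_iff)
  qed
  then have "(\<integral>y. (\<integral>t. f t y \<partial>lborel) \<partial>lborel) = 2 * pi"
    using cauchy_kernel_integral[of s] s by (simp add: vline_def G_def)
  \<comment> \<open>Integrating over \<open>y\<close> first: scaling moves the line to abscissa
    \<open>t / 2\<close>, where the integral is again \<open>K\<close>. The factor
    \<open>t powr (s - 1)\<close> remains and integrates to \<open>Gamma s\<close>.\<close>
  moreover have "(\<integral>y. f t y \<partial>lborel) = of_real (indicator {0<..} t * (t powr (s - 1) * exp (- 1 * t))) * K" for t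
  proof (cases "t > 0")
    case True
    have "(\<integral>y. f t y \<partial>lborel) = exp (- of_real t) * vline (\<lambda>u. exp (of_real t * u) * u powr (- of_real s)) (1/2)"
      using True by (simp add: f_def vline_def G_def)
    also have "\<dots> = exp (- of_real t) * (of_real (t powr (s - 1)) * K)"
      using True K[of "t * (1/2)"] by (simp only: hankel_scale[OF True])
    finally show ?thesis
      using True by (simp add: exp_of_real[symmetric] mult_ac)
  qed (simp add: f_def)
  moreover have "has_bochner_integral lborel (\<lambda>t. complex_of_real (indicator {0<..} t * (t powr (s - 1) * exp (- 1 * t))) * K)
      (complex_of_real (Gamma (s - 1 + 1) / 1 powr (s - 1 + 1)) * K)"
    by (intro has_bochner_integral_mult_left has_bochner_integral_of_real has_bochner_integral_Gamma)
      (use s in auto)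
  ultimately have "of_real (Gamma s) * K = 2 * pi"
    using lborel_pair.Fubini_integral[OF f_int] by (simp add: has_bochner_integral_iff)
  moreover have "Gamma s > 0" using s by (intro Gamma_real_pos) simp
  ultimately show ?thesis unfolding K_def[symmetric] by (simp add: field_simps)
qed

section \<open>The case \<open>\<alpha> \<le> 1\<close>\<close>

lemma norm_powr_minus_two: "u \<noteq> 0 \<Longrightarrow> norm (u powr (- 2)) = 1 / (norm u)\<^sup>2" for u :: complex
  by (subst norm_powr_real_powr') (auto simp: powr_minus powr_numeral divide_inverse)

text \<open>Expand 1/(u^a + z) as a geometric series in -z/u^a, which converges since |u^a| >= r^a >
  |z| on the line. The \<open>j\<close>-th term is Hankel's integral with exponent
  \<open>s j\<close>, and the majorant with ratio \<open>q\<close> justifies integrating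
  termwise.\<close>

lemma Etilde_sums:
  assumes a: "a = 2 - \<alpha>" "a \<ge> 1" and r: "r > 0" and z: "norm z < r powr a"
  shows "(\<lambda>j. (-1) ^ j * z ^ j / of_real (Gamma ((2 - \<alpha>) * (real j + 1) + 2))) sums
    (vline (\<lambda>u. exp u * u powr (- 2) / (u powr of_real a + z)) r / (2 * pi))"
proof -
  define s where "s j = a * (real j + 1) + 2" for j
  have s: "s j \<ge> 2" for j using a by (simp add: s_def)
  define f where "f j y = (- z) ^ j * (exp (Complex r y) * Complex r y powr (- of_real (s j)))" for j y
  define q where "q = norm z * r powr (- a)"
  define D where "D = exp r * r powr (- a)"
  have q: "0 \<le> q" "q < 1" using z r by (auto simp: q_def powr_minus field_simps)
  have geo: "summable (\<lambda>j. q ^ j * c)" for c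
    using q by (intro summable_mult2 summable_geometric) auto
  have int_hankel: "integrable lborel (\<lambda>y. exp (Complex r y) * Complex r y powr (- of_real (s j)))" for j
    using integrable_vline[OF hankel_integrand_holomorphic[of 1 "s j"] hankel_integrand_bound[OF s, of _ _ 1], of r] r
    by simp
  then have int: "integrable lborel (f j)" for j unfolding f_def by simp
  have val: "(\<integral>y. f j y \<partial>lborel) = (- z) ^ j * (2 * pi / Gamma (s j))" for j
    using vline_hankel[OF s r, of j] by (simp add: f_def vline_def)
  have f_le: "norm (f j y) \<le> q ^ j * (D * (1 / (r\<^sup>2 + y\<^sup>2)))" for j y
  proof -
    have "norm (f j y) = norm z ^ j * (exp r * norm (Complex r y powr (- of_real (s j))))"
      by (simp add: f_def norm_mult norm_power)
    also have "\<dots> \<le> norm z ^ j * (exp r * (r powr (2 - s j) * (1 / (norm (Complex r y))\<^sup>2)))"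
      by (intro mult_left_mono norm_powr_minus_le s) (use r in auto)
    also have "r powr (2 - s j) = (r powr (- a)) ^ j * r powr (- a)"
      using r by (simp add: s_def powr_power_mult algebra_simps flip: powr_add)
    finally show ?thesis
      by (simp add: q_def D_def power_mult_distrib cmod_power2 mult_ac)
  qed
  have I: "has_bochner_integral lborel (\<lambda>y. q ^ j * (D * (1 / (r\<^sup>2 + y\<^sup>2)))) (q ^ j * (D * (pi / r)))" for j
    by (intro has_bochner_integral_mult_right has_bochner_integral_inverse_square r)
  have "(\<lambda>j. \<integral>y. f j y \<partial>lborel) sums (\<integral>y. (\<Sum>j. f j y) \<partial>lborel)"
  proof (rule sums_integral[OF int])
    have "summable (\<lambda>j. norm (f j y))" for y
      by (rule summable_comparison_test'[OF geo[of "D * (1 / (r\<^sup>2 + y\<^sup>2))"], of 0]) (use f_le in simp)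
    then show "AE y in lborel. summable (\<lambda>j. norm (f j y))" by simp
    show "summable (\<lambda>j. \<integral>y. norm (f j y) \<partial>lborel)"
    proof (rule summable_comparison_test[OF _ geo])
      have "norm (\<integral>y. norm (f j y) \<partial>lborel) \<le> q ^ j * (D * (pi / r))" for j
      proof -
        have "(\<integral>y. norm (f j y) \<partial>lborel) \<le> q ^ j * (D * (pi / r))"
          by (rule has_bochner_integral_mono[OF _ I f_le])
            (use int in \<open>simp add: has_bochner_integral_iff\<close>)
        then show ?thesis by simp
      qed
      then show "\<exists>N. \<forall>j\<ge>N. norm (\<integral>y. norm (f j y) \<partial>lborel) \<le> q ^ j * (D * (pi / r))" by blast
    qed
  qed
  moreover have "(\<Sum>j. f j y) = exp (Complex r y) * Complex r y powr (- 2) / (Complex r y powr of_real a + z)" for y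
  proof -
    let ?u = "Complex r y"
    define v where "v = ?u powr of_real a"
    have u: "?u \<noteq> 0" using r by (auto simp: complex_eq_iff)
    have v: "v \<noteq> 0" using u by (simp add: v_def)
    have "r powr a \<le> norm ?u powr a"
      using r a complex_Re_le_cmod[of ?u] by (intro powr_mono2) auto
    also have "\<dots> = norm v" unfolding v_def by (subst norm_powr_real_powr') auto
    finally have zv: "norm z < norm v" using z by simp
    have "f j y = exp ?u * ?u powr (- 2) / v * (- z / v) ^ j" for j
    proof -
      have "?u powr (- of_real (s j)) = ?u powr (- 2) * inverse v * inverse (v ^ j)"
        using u by (simp add: s_def v_def powr_def algebra_simps flip: exp_add exp_minus exp_of_nat_mult)
      then show ?thesis unfolding power_divide by (simp add: f_def divide_inverse mult_ac)
    qed
    moreover have "(\<lambda>j. exp ?u * ?u powr (- 2) / v * (- z / v) ^ j) sums (exp ?u * ?u powr (- 2) / v * (1 / (1 - - z / v)))"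
      using zv by (intro sums_mult geometric_sums) (simp add: norm_divide divide_less_eq)
    moreover have "1 - - z / v = (v + z) / v"
      using v by (simp add: add_divide_distrib)
    then have "exp ?u * ?u powr (- 2) / v * (1 / (1 - - z / v)) = exp ?u * ?u powr (- 2) / (v + z)"
      using v by simp
    ultimately show ?thesis by (simp add: v_def sums_iff)
  qed
  ultimately have "(\<lambda>j. (- z) ^ j * (2 * pi / Gamma (s j)) / (2 * pi)) sums
      (vline (\<lambda>u. exp u * u powr (- 2) / (u powr of_real a + z)) r / (2 * pi))"
    unfolding val vline_def by (intro sums_divide) simp
  moreover have "(- z) ^ j * (2 * pi / Gamma (s j)) / (2 * pi) =
      (-1) ^ j * z ^ j / of_real (Gamma ((2 - \<alpha>) * (real j + 1) + 2))" for j
    by (simp add: s_def a power_minus[of z])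
  ultimately show ?thesis by simp
qed

text \<open>Since \<open>a \<ge> 1\<close>, the image of the half-plane under \<open>u \<mapsto> u powr a\<close> widens away from the
  boundary at least as fast as the half-plane itself.\<close>

lemma powr_sector_distance:
  assumes a: "a \<ge> 1" and u: "Re u > 0" and w: "\<bar>Im w\<bar> < (2 - a) * pi / 2"
  shows "Re u powr a \<le> norm (u powr of_real a + exp w)"
proof -
  \<comment> \<open>With z = \<open>exp w\<close>, \<open>x\<close> is |z|/|u|^a and
    \<open>\<delta>\<close> is the angle from u^a to z, so u^a + z = u^a (1 + x cis \<delta>). As Re
    u = |u| cos \<theta>, it suffices to bound the second factor below by (cos \<theta>)^a.\<close>
  define \<theta> where "\<theta> = Im (Ln u)"
  define \<delta> where "\<delta> = Im w - a * \<theta>"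
  define x where "x = exp (Re w - a * ln (norm u))"
  have u0: "u \<noteq> 0" using u by auto
  have \<theta>: "\<bar>\<theta>\<bar> < pi / 2" using u u0 Re_Ln_pos_lt[of u] by (simp add: \<theta>_def)
  have c: "0 < cos \<theta>" "cos \<theta> \<le> 1" using \<theta> by (auto intro!: cos_gt_zero_pi)
  have "u = exp (Ln u)" using u0 by simp
  then have "Re u = exp (Re (Ln u)) * cos \<theta>" by (metis Re_exp \<theta>_def)
  then have Re_u: "Re u = norm u * cos \<theta>" using u0 by simp
  have factor: "u powr of_real a + exp w = u powr of_real a * (1 + of_real x * cis \<delta>)"
  proof -
    have "exp w = u powr of_real a * exp (w - of_real a * Ln u)"
      using u0 by (simp add: powr_def flip: exp_add)
    also have "exp (w - of_real a * Ln u) = of_real x * cis \<delta>"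
      using u0 by (simp add: exp_eq_polar x_def \<delta>_def \<theta>_def)
    finally show ?thesis by (simp add: distrib_left)
  qed
  \<comment> \<open>If \<open>\<delta>\<close> is at most a right angle in modulus, the real part is
    already at least 1. Otherwise the norm is at least |sin \<delta>|, and \<open>a \<ge> 1\<close>
    limits the excess of |\<delta>| over a right angle to |\<theta>|.\<close>
  have "cos \<theta> \<le> norm (1 + of_real x * cis \<delta>)"
  proof (cases "\<bar>\<delta>\<bar> \<le> pi / 2")
    case True
    then have "0 \<le> cos \<delta>" by (intro cos_ge_zero) auto
    then have "1 \<le> Re (1 + of_real x * cis \<delta>)" by (simp add: x_def)
    then show ?thesis using c complex_Re_le_cmod[of "1 + of_real x * cis \<delta>"] by linarith
  next
    case False
    have "\<bar>\<delta>\<bar> \<le> \<bar>Im w\<bar> + a * \<bar>\<theta>\<bar>"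
      using a abs_triangle_ineq4[of "Im w" "a * \<theta>"] by (simp add: \<delta>_def abs_mult)
    also have "\<dots> \<le> pi - a * (pi / 2 - \<bar>\<theta>\<bar>)" using w by (simp add: algebra_simps)
    also have "\<dots> \<le> pi - 1 * (pi / 2 - \<bar>\<theta>\<bar>)"
      using a \<theta> by (intro diff_left_mono mult_right_mono) auto
    finally have d: "\<bar>\<delta>\<bar> - pi / 2 \<le> \<bar>\<theta>\<bar>" by simp
    have "cos \<bar>\<theta>\<bar> \<le> cos (\<bar>\<delta>\<bar> - pi / 2)"
      using d False \<theta> by (intro cos_monotone_0_pi_le) auto
    also have "\<dots> = sin \<bar>\<delta>\<bar>" by (simp add: cos_diff)
    also have "\<dots> \<le> \<bar>sin \<delta>\<bar>" by (cases "\<delta> \<ge> 0") auto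
    also have "\<dots> = \<bar>Im (cis (- \<delta>) + of_real x)\<bar>" by simp
    also have "\<dots> \<le> norm (cis (- \<delta>) + of_real x)" by (rule abs_Im_le_cmod)
    also have "cis (- \<delta>) + of_real x = cis (- \<delta>) * (1 + of_real x * cis \<delta>)"
      by (simp add: algebra_simps cis_mult)
    also have "norm \<dots> = norm (1 + of_real x * cis \<delta>)" by (simp add: norm_mult)
    finally show ?thesis by simp
  qed
  moreover have "cos \<theta> powr a \<le> cos \<theta> powr 1" using c a by (intro powr_mono') auto
  ultimately have "cos \<theta> powr a \<le> norm (1 + of_real x * cis \<delta>)" using c by simp
  then have "norm u powr a * cos \<theta> powr a \<le> norm u powr a * norm (1 + of_real x * cis \<delta>)"
    by (intro mult_left_mono) auto
  also have "norm u powr a * cos \<theta> powr a = Re u powr a"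
    using c by (simp add: Re_u powr_mult)
  also have "norm u powr a * norm (1 + of_real x * cis \<delta>) = norm (u powr of_real a + exp w)"
    unfolding factor norm_mult by (subst norm_powr_real_powr') auto
  finally show ?thesis .
qed

text \<open>For Re u > p the point u^a has distance at least p^a >= 2 \<rho> from -exp w, hence at
  least \<rho> from -z. The line can therefore be moved from a large abscissa, where the series
  representation holds, to \<open>2 * p\<close>, where the integral is estimated directly.\<close>

lemma norm_Etilde_le:
  assumes \<alpha>: "0 < \<alpha>" "\<alpha> \<le> 1" and w: "w \<in> logstrip \<alpha>" and z: "norm (z - exp w) \<le> \<rho>"
    and \<rho>: "0 < \<rho>" "2 * \<rho> \<le> p powr (2 - \<alpha>)" and p: "p > 0"
  shows "norm (Etilde \<alpha> z) \<le> exp (2 * p) / (4 * p * \<rho>)"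
proof -
  define a where "a = 2 - \<alpha>"
  have a: "a = 2 - \<alpha>" "a \<ge> 1" using \<alpha> by (auto simp: a_def)
  define F where "F u = exp u * u powr (- 2) / (u powr of_real a + z)" for u
  have den: "\<rho> \<le> norm (u powr of_real a + z)" if "Re u > p" for u
  proof -
    have "2 * \<rho> \<le> Re u powr a"
      using \<rho>(2) powr_mono2[of a p "Re u"] that p a by simp
    also have "\<dots> \<le> norm (u powr of_real a + exp w)"
      using w a that p by (intro powr_sector_distance) (auto simp: logstrip_def)
    also have "\<dots> = norm ((u powr of_real a + z) - (z - exp w))" by simp
    also have "\<dots> \<le> norm (u powr of_real a + z) + norm (z - exp w)" by (rule norm_triangle_ineq4)
    finally show ?thesis using z by simp
  qed
  have F_le: "norm (F u) \<le> exp (Re u) / \<rho> * (1 / (norm u)\<^sup>2)" if "Re u > p" for u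
  proof -
    have "u \<noteq> 0" using that p by auto
    then have "norm (F u) = exp (Re u) * (1 / (norm u)\<^sup>2) / norm (u powr of_real a + z)"
      by (simp add: F_def norm_mult norm_divide norm_powr_minus_two)
    also have "\<dots> \<le> exp (Re u) * (1 / (norm u)\<^sup>2) / \<rho>"
      using den[OF that] \<rho> by (intro divide_left_mono mult_pos_pos) auto
    finally show ?thesis by (simp add: mult.commute)
  qed
  have holo: "F holomorphic_on {u. Re u > p}"
    unfolding F_def
  proof (intro holomorphic_intros)
    fix u assume "u \<in> {u. Re u > p}"
    then show "u powr of_real a + z \<noteq> 0" using den[of u] \<rho> by auto
  qed (use p in \<open>auto simp: complex_nonpos_Reals_iff\<close>)
  have bound: "\<exists>C. \<forall>u. r0 \<le> Re u \<and> Re u \<le> r1 \<longrightarrow> norm (F u) \<le> C / (1 + (Im u)\<^sup>2)" if r0: "p < r0" for r0 r1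
  proof (intro exI allI impI)
    fix u assume u: "r0 \<le> Re u \<and> Re u \<le> r1"
    have "norm (F u) \<le> exp (Re u) / \<rho> * (1 / (norm u)\<^sup>2)" using u r0 by (intro F_le) auto
    also have "\<dots> \<le> exp r1 / \<rho> * ((1 + 1 / r0\<^sup>2) / (1 + (Im u)\<^sup>2))"
      using u r0 p \<rho> by (intro mult_mono divide_right_mono inverse_norm_square_le) auto
    finally show "norm (F u) \<le> exp r1 / \<rho> * (1 + 1 / r0\<^sup>2) / (1 + (Im u)\<^sup>2)" by simp
  qed
  \<comment> \<open>Large enough that \<open>R \<ge> 1\<close> and
    \<open>norm z < R \<le> R powr a\<close>, as the series representation requires.\<close>
  define R where "R = norm z + p + 1"
  have R: "R > p" "R > 0" using p by (auto simp: R_def add_nonneg_pos)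
  have "norm z < R powr 1" using p by (simp add: R_def)
  also have "\<dots> \<le> R powr a" using a p by (intro powr_mono) (auto simp: R_def)
  finally have "Etilde \<alpha> z = vline F R / (2 * pi)"
    using Etilde_sums[OF a R(2), of z] by (simp add: Etilde_def sums_iff F_def[abs_def])
  also have "vline F R = vline F (2 * p)"
    by (rule vline_eq[OF holo bound]) (use R p in auto)
  finally have E: "norm (Etilde \<alpha> z) = norm (vline F (2 * p)) / (2 * pi)"
    by (simp add: norm_divide norm_mult)
  have I: "has_bochner_integral lborel (\<lambda>y. exp (2 * p) / \<rho> * (1 / ((2 * p)\<^sup>2 + y\<^sup>2))) (exp (2 * p) / \<rho> * (pi / (2 * p)))"
    using p by (intro has_bochner_integral_mult_right has_bochner_integral_inverse_square) auto
  have "norm (vline F (2 * p)) \<le> (\<integral>y. exp (2 * p) / \<rho> * (1 / ((2 * p)\<^sup>2 + y\<^sup>2)) \<partial>lborel)"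
    unfolding vline_def
  proof (rule order_trans[OF integral_norm_bound integral_mono'])
    show "norm (F (Complex (2 * p) y)) \<le> exp (2 * p) / \<rho> * (1 / ((2 * p)\<^sup>2 + y\<^sup>2))" for y
      using F_le[of "Complex (2 * p) y"] p by (simp add: cmod_power2)
  qed (use I \<rho> in \<open>auto simp: has_bochner_integral_iff\<close>)
  also have "\<dots> = exp (2 * p) / \<rho> * (pi / (2 * p))" using I by (simp only: has_bochner_integral_iff)
  finally show ?thesis
    unfolding E using p \<rho> by (simp add: field_simps)
qed

section \<open>Derivatives of the Mittag-Leffler type function\<close>

lemma Etilde_entire:
  assumes \<alpha>: "\<alpha> \<le> 1"
  shows "Etilde \<alpha> holomorphic_on UNIV"
    and "(deriv ^^ n) (Etilde \<alpha>) 0 = of_real ((-1) ^ n * fact n / Gamma ((2 - \<alpha>) * (real n + 1) + 2))"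
proof -
  define c where "c n = complex_of_real ((-1) ^ n / Gamma ((2 - \<alpha>) * (real n + 1) + 2))" for n
  have sums: "(\<lambda>n. c n * z ^ n) sums Etilde \<alpha> z" for z
  proof -
    \<comment> \<open>The integral representation with \<open>r = norm z + 1\<close> already
      contains convergence of the series at \<open>z\<close>.\<close>
    have "norm z < (norm z + 1) powr 1" by simp
    also have "\<dots> \<le> (norm z + 1) powr (2 - \<alpha>)" using \<alpha> by (intro powr_mono) auto
    finally have "summable (\<lambda>n. (-1) ^ n * z ^ n / of_real (Gamma ((2 - \<alpha>) * (real n + 1) + 2)))"
      using Etilde_sums[OF refl, where \<alpha> = \<alpha> and r = "norm z + 1" and z = z] \<alpha> by (auto simp: sums_iff add_nonneg_pos)
    then show ?thesis
      by (simp add: c_def Etilde_def sums_iff mult_ac)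
  qed
  have "Etilde \<alpha> field_differentiable at z" for z
  proof -
    have "Etilde \<alpha> holomorphic_on ball 0 (norm z + 1)"
      by (rule power_series_holomorphic[where a = c]) (use sums in simp)
    then show ?thesis
      by (rule holomorphic_on_imp_differentiable_at) auto
  qed
  then show "Etilde \<alpha> holomorphic_on UNIV"
    by (simp add: holomorphic_on_def field_differentiable_at_within)
  have "eval_fps (Abs_fps c) = Etilde \<alpha>"
    using sums by (auto simp: eval_fps_def sums_iff fun_eq_iff)
  moreover have "fps_conv_radius (Abs_fps c) > 0"
  proof -
    have "summable (\<lambda>n. c n * 1 ^ n)" using sums[of 1] by (rule sums_summable)
    then have "conv_radius c \<ge> ereal (norm (1 :: complex))" by (rule conv_radius_geI)
    then have "0 < conv_radius c" by (rule less_le_trans[rotated]) simp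
    then show ?thesis by (simp add: fps_conv_radius_def)
  qed
  ultimately have "c n = (deriv ^^ n) (Etilde \<alpha>) 0 / fact n"
    using fps_nth_conv_deriv[of "Abs_fps c" n] by simp
  then show "(deriv ^^ n) (Etilde \<alpha>) 0 = of_real ((-1) ^ n * fact n / Gamma ((2 - \<alpha>) * (real n + 1) + 2))"
    by (simp add: c_def field_simps)
qed

text \<open>Cauchy's inequality with radius \<rho> = (n+1)^a. On that circle the function grows only
  geometrically in \<open>n\<close>, and n!/\<rho>^n <= n^n / n^(a n) is the weight n^((\<alpha>-1)
  n).\<close>

lemma norm_deriv_Etilde_le:
  assumes \<alpha>: "0 < \<alpha>" "\<alpha> \<le> 1" and w: "w \<in> logstrip \<alpha>"
  shows "norm ((deriv ^^ n) (Etilde \<alpha>) (exp w)) \<le> exp 4 * exp 4 ^ n * Gbar (\<alpha> - 1) (\<lambda>_. 1) n"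
proof -
  define a where "a = 2 - \<alpha>"
  define \<rho> where "\<rho> = (real n + 1) powr a"
  have a: "1 \<le> a" using \<alpha> by (simp add: a_def)
  have \<rho>1: "1 \<le> \<rho>" using a by (simp add: \<rho>_def ge_one_powr_ge_zero)
  have E_le: "norm (Etilde \<alpha> z) \<le> exp 4 * exp 4 ^ n" if "norm (exp w - z) = \<rho>" for z
  proof -
    have "(2::real) powr 1 \<le> 2 powr a" using a by (intro powr_mono) auto
    \<comment> \<open>Here \<open>p = 2 * (n + 1)\<close>: then p^a = 2^a \<rho> >= 2 \<rho>, and
      exp (2 p) is still geometric in \<open>n\<close>.\<close>
    then have "2 * \<rho> \<le> (2 * (real n + 1)) powr (2 - \<alpha>)"
      unfolding \<rho>_def a_def[symmetric] by (subst powr_mult) auto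
    then have "norm (Etilde \<alpha> z) \<le> exp (2 * (2 * (real n + 1))) / (4 * (2 * (real n + 1)) * \<rho>)"
      using \<rho>1 that by (intro norm_Etilde_le[OF \<alpha> w]) (auto simp: norm_minus_commute)
    also have "\<dots> \<le> exp (2 * (2 * (real n + 1))) / 1"
    proof (intro divide_left_mono)
      have "1 * 1 \<le> (4 * (2 * (real n + 1))) * \<rho>" using \<rho>1 by (intro mult_mono) auto
      then show "1 \<le> 4 * (2 * (real n + 1)) * \<rho>" by simp
    qed (use \<rho>1 in auto)
    also have "exp (2 * (2 * (real n + 1))) = exp 4 * exp 4 ^ n"
      by (simp add: distrib_left exp_add mult.commute flip: exp_of_nat2_mult)
    finally show ?thesis by simp
  qed
  have "norm ((deriv ^^ n) (Etilde \<alpha>) (exp w)) \<le> fact n * (exp 4 * exp 4 ^ n) / \<rho> ^ n"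
  proof (rule Cauchy_inequality)
    show "Etilde \<alpha> holomorphic_on ball (exp w) \<rho>"
      using Etilde_entire(1)[OF \<alpha>(2)] by (rule holomorphic_on_subset) auto
    show "continuous_on (cball (exp w) \<rho>) (Etilde \<alpha>)"
      by (rule holomorphic_on_imp_continuous_on[OF holomorphic_on_subset[OF Etilde_entire(1)[OF \<alpha>(2)]]]) auto
  qed (use \<rho>1 E_le in auto)
  also have "\<dots> = exp 4 * exp 4 ^ n * (fact n / \<rho> ^ n)" by simp
  also have "\<dots> \<le> exp 4 * exp 4 ^ n * Gbar (\<alpha> - 1) (\<lambda>_. 1) n"
  proof (intro mult_left_mono)
    show "fact n / \<rho> ^ n \<le> Gbar (\<alpha> - 1) (\<lambda>_. 1) n"
    proof (cases "n = 0")
      case False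
      have "fact n \<le> real n ^ n" using fact_le_power[of n, where 'a = real] by simp
      moreover have "real n powr (a * real n) \<le> \<rho> ^ n"
        using a by (simp add: \<rho>_def powr_power_mult powr_mono2)
      ultimately have "fact n / \<rho> ^ n \<le> real n ^ n / real n powr (a * real n)"
        using False by (intro frac_le) auto
      also have "\<dots> = real n powr ((\<alpha> - 1) * real n)"
        using False by (simp add: a_def algebra_simps flip: powr_realpow powr_diff)
      finally show ?thesis using False by (simp add: Gbar_one)
    qed (simp add: Gbar_one)
  qed auto
  finally show ?thesis .
qed

lemma Gamma_Etilde_le:
  assumes \<alpha>: "0 < \<alpha>" "\<alpha> \<le> 1"
  shows "Gamma ((2 - \<alpha>) * (real n + 1) + 2) \<le> 2000 * (100 * exp 3) ^ n * Gbar (2 - \<alpha>) (\<lambda>_. 1) n"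
proof -
  define a where "a = 2 - \<alpha>"
  \<comment> \<open>Replacing \<open>n\<close> by \<open>N\<close> covers \<open>n = 0\<close>,
    where \<open>N powr (a * n) = 1\<close> agrees with \<open>Gbar\<close>. From
    \<open>a \<le> 2\<close> follow \<open>2 * x \<le> 10 * N\<close>, 10^(a n) <= 100^n and (10
    N)^(a+1) <= 1000 N^3 <= 1000 exp(3)^n.\<close>
  define N where "N = max 1 (real n)"
  define x where "x = a * real n + (a + 1)"
  have a: "1 \<le> a" "a \<le> 2" using \<alpha> by (auto simp: a_def)
  have N: "1 \<le> N" "real n \<le> N" by (auto simp: N_def)
  have x: "0 < x" using a by (simp add: x_def add_nonneg_pos)
  have "Gamma ((2 - \<alpha>) * (real n + 1) + 2) = Gamma (x + 1)"
    by (simp add: x_def a_def algebra_simps)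
  also have "\<dots> \<le> 2 * ((2 * x) powr x * exp (- x))" by (rule Gamma_plus1_le[OF x])
  also have "\<dots> \<le> 2 * ((10 * N) powr x * 1)"
  proof -
    have "a * real n \<le> 2 * N" using a N by (intro mult_mono) auto
    then have "2 * x \<le> 10 * N" using a N by (simp add: x_def)
    then have "(2 * x) powr x \<le> (10 * N) powr x" using x by (intro powr_mono2) auto
    then have "(2 * x) powr x * exp (- x) \<le> (10 * N) powr x * 1" by (rule mult_mono) (use x in auto)
    then show ?thesis by simp
  qed
  also have "(10 * N) powr x = 10 powr (a * real n) * N powr (a * real n) * (10 * N) powr (a + 1)"
    using N by (simp add: x_def powr_add powr_mult)
  also have "N powr (a * real n) = Gbar a (\<lambda>_. 1) n" by (auto simp: N_def Gbar_one)
  also have "2 * (10 powr (a * real n) * Gbar a (\<lambda>_. 1) n * (10 * N) powr (a + 1) * 1) \<le>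
      2 * (100 ^ n * Gbar a (\<lambda>_. 1) n * (1000 * exp 3 ^ n) * 1)"
  proof -
    have "10 powr (a * real n) \<le> 10 powr (2 * real n)" using a by (intro powr_mono mult_right_mono) auto
    also have "\<dots> = 100 ^ n" by (simp add: powr_powr[symmetric] powr_realpow)
    finally have 1: "10 powr (a * real n) \<le> (100::real) ^ n" .
    have "real n \<le> exp (real n)" using exp_ge_add_one_self[of "real n"] by linarith
    then have "N \<le> exp (real n)" by (simp add: N_def)
    then have "N ^ 3 \<le> exp (real n) ^ 3" using N by (intro power_mono) auto
    also have "\<dots> = exp 3 ^ n" by (simp add: exp_of_nat2_mult[symmetric] mult.commute flip: exp_of_nat_mult)
    finally have "N ^ 3 \<le> exp 3 ^ n" .
    moreover have "(10 * N) powr (a + 1) \<le> (10 * N) powr 3" using a N by (intro powr_mono) auto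
    moreover have "(10 * N) powr 3 = 1000 * N ^ 3" using N by (simp add: powr_numeral power_mult_distrib)
    ultimately have 2: "(10 * N) powr (a + 1) \<le> 1000 * exp 3 ^ n" by simp
    have "0 \<le> Gbar a (\<lambda>_. 1) n" by (simp add: Gbar_one)
    with 1 2 show ?thesis by (intro mult_left_mono mult_mono) auto
  qed
  finally show ?thesis by (simp add: a_def power_mult_distrib mult_ac)
qed

proposition characteristic_Etilde:
  assumes \<alpha>: "0 < \<alpha>" "\<alpha> \<le> 1" and M: "pos_seq M" and L: "log_convex L"
    and equiv: "seq_equiv M (\<lambda>n. Gbar (\<alpha> - 1) (\<lambda>_. 1) n * L n)"
  shows "characteristic (transform L (\<lambda>z. Etilde \<alpha> (coord z))) M (sector \<alpha>)"
proof -
  define F where "F n w = (deriv ^^ n) (Etilde \<alpha>) (exp w)" for n w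
  have holo: "(deriv ^^ n) (Etilde \<alpha>) holomorphic_on UNIV" for n
    using Etilde_entire(1)[OF \<alpha>(2)] by (rule holomorphic_higher_deriv) simp
  show ?thesis
  proof (rule characteristic_transformI[where F = F and G = "Gbar (\<alpha> - 1) (\<lambda>_. 1)"
        and c = "\<lambda>n. (deriv ^^ n) (Etilde \<alpha>) 0" and a = "1 / 2000" and h = "1 / (exp 1 * (100 * exp 3))"])
    show "deriv_tower (logstrip \<alpha>) F"
      unfolding deriv_tower_def
    proof (intro allI ballI)
      fix n w
      have "((deriv ^^ n) (Etilde \<alpha>) has_field_derivative (deriv ^^ Suc n) (Etilde \<alpha>) (exp w)) (at (exp w))"
        using holomorphic_derivI[OF holo open_UNIV] by simp
      from DERIV_chain2[OF this DERIV_exp]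
      show "(F n has_field_derivative exp w * F (Suc n) w) (at w)"
        unfolding F_def by (simp add: mult.commute)
    qed
    show "norm (F n w) \<le> exp 4 * exp 4 ^ n * Gbar (\<alpha> - 1) (\<lambda>_. 1) n" if "w \<in> logstrip \<alpha>" for n w
      unfolding F_def by (rule norm_deriv_Etilde_le[OF \<alpha> that])
    show "((\<lambda>x::real. F n (of_real x)) \<longlongrightarrow> (deriv ^^ n) (Etilde \<alpha>) 0) at_bot" for n
    proof -
      have cont: "isCont ((deriv ^^ n) (Etilde \<alpha>)) 0"
        using holomorphic_on_imp_continuous_on[OF holo[of n]] by (simp add: continuous_on_eq_continuous_at)
      have "((\<lambda>x::real. complex_of_real (exp x)) \<longlongrightarrow> of_real 0) at_bot"
        by (intro tendsto_of_real exp_at_bot)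
      then have "((\<lambda>x::real. exp (complex_of_real x)) \<longlongrightarrow> 0) at_bot"
        by (simp add: exp_of_real)
      then show ?thesis
        unfolding F_def by (rule isCont_tendsto_compose[OF cont])
    qed
    \<comment> \<open>The limit has modulus n!/Gamma(a (n+1) + 2) with a = 2 - \<alpha>. Up to
      geometric factors the numerator is at least n^n and the denominator at most n^(a n), which
      leaves n^((\<alpha>-1) n).\<close>
    show "1 / 2000 * (1 / (exp 1 * (100 * exp 3))) ^ n * Gbar (\<alpha> - 1) (\<lambda>_. 1) n \<le> norm ((deriv ^^ n) (Etilde \<alpha>) 0)" for n
    proof -
      let ?D = "2000 * (100 * exp 3) ^ n * Gbar (2 - \<alpha>) (\<lambda>_. 1) n :: real"
      have pos: "Gamma ((2 - \<alpha>) * (real n + 1) + 2) > 0"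
        using \<alpha> by (intro Gamma_real_pos add_nonneg_pos mult_nonneg_nonneg) auto
      have "(1 / exp 1) ^ n * Gbar 1 (\<lambda>_. 1) n \<le> fact n"
        using Gamma_ge_Gbar[of 1 n] by (simp add: Gamma_fact[symmetric] add.commute)
      then have le: "(1 / exp 1) ^ n * Gbar 1 (\<lambda>_. 1) n / ?D \<le> fact n / Gamma ((2 - \<alpha>) * (real n + 1) + 2)"
        using Gamma_Etilde_le[OF \<alpha>, of n] pos by (intro frac_le) auto
      have "Gbar (\<alpha> - 1) (\<lambda>_. 1) n = Gbar 1 (\<lambda>_. 1) n / Gbar (2 - \<alpha>) (\<lambda>_. 1) n"
        by (simp add: Gbar_one algebra_simps flip: powr_diff)
      then have "1 / 2000 * (1 / (exp 1 * (100 * exp 3))) ^ n * Gbar (\<alpha> - 1) (\<lambda>_. 1) n =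
          (1 / exp 1) ^ n * Gbar 1 (\<lambda>_. 1) n / ?D"
        by (simp add: power_mult_distrib power_divide)
      also note le
      also have "fact n / Gamma ((2 - \<alpha>) * (real n + 1) + 2) = norm ((deriv ^^ n) (Etilde \<alpha>) 0)"
        unfolding Etilde_entire(2)[OF \<alpha>(2)] norm_of_real using pos by (simp add: abs_mult abs_divide power_abs)
      finally show ?thesis .
    qed
    show "pos_seq (Gbar (\<alpha> - 1) (\<lambda>_. 1))" by (simp add: pos_seq_def Gbar_def)
  qed (use assms in \<open>auto simp: F_def coord_def\<close>)
qed

section \<open>Conclusion in both cases\<close>

text \<open>Multiplying both inequalities by n^(\<beta> n) moves the weight from \<open>M\<close> to
  \<open>L\<close>, the form in which the criterion uses the equivalence.\<close>

lemma seq_equiv_Gbar: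
  assumes "seq_equiv (Gbar (- \<beta>) M) L"
  shows "seq_equiv M (\<lambda>n. Gbar \<beta> (\<lambda>_. 1) n * L n)"
proof -
  have M: "M n = Gbar \<beta> (\<lambda>_. 1) n * Gbar (- \<beta>) M n" for n
    by (simp add: Gbar_def powr_minus)
  obtain A B where "A > 0" "B > 0"
    and AB: "\<And>n. Gbar (- \<beta>) M n \<le> A * B ^ n * L n" "\<And>n. L n \<le> A * B ^ n * Gbar (- \<beta>) M n"
    using assms by (auto simp: seq_equiv_def)
  have G: "Gbar \<beta> (\<lambda>_. 1) n \<ge> 0" for n by (simp add: Gbar_def)
  have "M n \<le> A * B ^ n * (Gbar \<beta> (\<lambda>_. 1) n * L n)"
    "Gbar \<beta> (\<lambda>_. 1) n * L n \<le> A * B ^ n * M n" for n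
    using mult_left_mono[OF AB(1) G, of n n] mult_left_mono[OF AB(2) G, of n n]
    by (simp_all add: M[of n] mult_ac)
  with \<open>A > 0\<close> \<open>B > 0\<close> show ?thesis unfolding seq_equiv_def by blast
qed

theorem theorem4p9:
  fixes M :: "nat \<Rightarrow> real" and \<alpha> :: real
  assumes "pos_seq M" and "M 0 = 1" and "\<alpha> > 0"
  shows "(\<alpha> \<le> 1 \<longrightarrow>
            (\<forall>L. log_convex L \<and> L 0 = 1 \<and> seq_equiv (Gbar (1 - \<alpha>) M) L \<longrightarrow>
               characteristic (transform L (\<lambda>z. Etilde \<alpha> (coord z))) M (sector \<alpha>))) \<and>
         (\<alpha> > 1 \<longrightarrow>
            (\<forall>\<alpha>' L. \<alpha>' > \<alpha> \<and> log_convex L \<and> L 0 = 1 \<and> seq_equiv (Gbar (1 - \<alpha>') M) L \<longrightarrow>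
               characteristic (transform L (g_fun \<alpha> \<alpha>')) M (sector \<alpha>)))"
proof (intro conjI impI allI)
  fix L assume \<alpha>: "\<alpha> \<le> 1" and L: "log_convex L \<and> L 0 = 1 \<and> seq_equiv (Gbar (1 - \<alpha>) M) L"
  then show "characteristic (transform L (\<lambda>z. Etilde \<alpha> (coord z))) M (sector \<alpha>)"
    using assms seq_equiv_Gbar[of "\<alpha> - 1" M L] by (intro characteristic_Etilde) auto
next
  fix \<alpha>' L assume \<alpha>: "1 < \<alpha>" and L: "\<alpha> < \<alpha>' \<and> log_convex L \<and> L 0 = 1 \<and> seq_equiv (Gbar (1 - \<alpha>') M) L"
  then show "characteristic (transform L (g_fun \<alpha> \<alpha>')) M (sector \<alpha>)"
    using assms seq_equiv_Gbar[of "\<alpha>' - 1" M L] by (intro characteristic_g) auto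
qed

end
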